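(* Let $T$ be a homogeneous tree. Let $\{A_t:t\in T\}$ be a family of measurable events in a probability space $(\Omega,\Sigma,\mu)$ satisfying $\mu(A_t)\geq\varepsilon>0$ for every $t\in T$. Then for every $0<\theta<\varepsilon$ there exists a strong subtree $S$ of $T$ of infinite height such that for every $s,t\in S$ we have $\mu(A_s\cap A_t)\geq\theta^2$.
   Context: A tree is a non-empty partially ordered set $(T,<)$ such that for every $t\in T$ the set $\{s\in T:s<t\}$ is finite and linearly ordered; its cardinality is the length $\ell_T(t)$ of $t$. For $n\in\mathbb{N}=\{0,1,2,\dots\}$ the $n$-level is $T(n)=\{t\in T:\ell_T(t)=n\}$. The height $h(T)$ is $\max\{n:T(n)\neq\emptyset\}+1$ if some level is empty, and $\infty$ otherwise. The immediate successors of $t$ in $T$ are the $s\geq t$ with $\ell_T(s)=\ell_T(t)+1$; write $\mathrm{ImmSucc}_T(t)$ for the set of them. $T$ is uniquely rooted if $|T(0)|=1$, and balanced if all maximal chains of $T$ have the same cardinality. A subtree of $T$ is a subset of $T$ with the induced order. A tree $T$ is homogeneous if it is uniquely rooted and there is an integer $b\geq 2$ (the branching number of $T$) such that every $t\in T$ has exactly $b$ immediate successors. A (finite or infinite) subtree $S$ of a uniquely rooted tree $T$ is strong if: (a) $S$ is uniquely rooted and balanced; (b) every level of $S$ is a subset of some level of $T$; (c) for every non-maximal node $s\in S$ and every $t\in\mathrm{ImmSucc}_T(s)$ there is a unique $s'\in\mathrm{ImmSucc}_S(s)$ with $t\leq s'$. *)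

theory Defs
  imports "HOL-Probability.Probability" "HOL-Library.Equipollence"
begin

text \<open>
  Trees are given by a carrier set together with a reflexive order relation on it; the
  induced order on a subset \<open>S\<close> is \<open>Restr r S\<close>. Here \<open>underS r t\<close> is the set
  of strict predecessors of \<open>t\<close> and \<open>aboveS r t\<close> the set of strict successors.
\<close>

definition is_tree :: "'a set \<Rightarrow> 'a rel \<Rightarrow> bool" where
  "is_tree T r \<longleftrightarrow> T \<noteq> {} \<and> partial_order_on T r \<and>
     (\<forall>t\<in>T. finite (underS r t) \<and> underS r t \<in> Chains r)"

definition tree_length :: "'a rel \<Rightarrow> 'a \<Rightarrow> nat" where
  "tree_length r t = card (underS r t)"

definition tree_level :: "'a set \<Rightarrow> 'a rel \<Rightarrow> nat \<Rightarrow> 'a set" where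
  "tree_level T r n = {t \<in> T. tree_length r t = n}"

definition tree_height :: "'a set \<Rightarrow> 'a rel \<Rightarrow> enat" where
  "tree_height T r =
     (if \<exists>n. tree_level T r n = {} then enat (Max {n. tree_level T r n \<noteq> {}} + 1) else \<infinity>)"

definition imm_succ :: "'a set \<Rightarrow> 'a rel \<Rightarrow> 'a \<Rightarrow> 'a set" where
  "imm_succ T r t = {s \<in> T. (t, s) \<in> r \<and> tree_length r s = tree_length r t + 1}"

definition uniquely_rooted :: "'a set \<Rightarrow> 'a rel \<Rightarrow> bool" where
  "uniquely_rooted T r \<longleftrightarrow> card (tree_level T r 0) = 1"

text \<open>Every \<open>C \<in> Chains r\<close> is a subset of the field of \<open>r\<close>.\<close>

definition maximal_chain :: "'a rel \<Rightarrow> 'a set \<Rightarrow> bool" where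
  "maximal_chain r C \<longleftrightarrow> C \<in> Chains r \<and> (\<forall>D\<in>Chains r. C \<subseteq> D \<longrightarrow> D = C)"

text \<open>
  Cardinalities are compared by equipollence, since \<open>card\<close> is \<open>0\<close> on
  infinite chains.
\<close>

definition balanced :: "'a rel \<Rightarrow> bool" where
  "balanced r \<longleftrightarrow> (\<forall>C D. maximal_chain r C \<and> maximal_chain r D \<longrightarrow> C \<approx> D)"

text \<open>The requirement \<open>b \<ge> 2\<close> makes the sets of immediate successors finite.\<close>

definition homogeneous_tree :: "'a set \<Rightarrow> 'a rel \<Rightarrow> bool" where
  "homogeneous_tree T r \<longleftrightarrow> is_tree T r \<and> uniquely_rooted T r \<and>
     (\<exists>b\<ge>2. \<forall>t\<in>T. card (imm_succ T r t) = b)"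

definition strong_subtree :: "'a set \<Rightarrow> 'a set \<Rightarrow> 'a rel \<Rightarrow> bool" where
  "strong_subtree S T r \<longleftrightarrow> S \<subseteq> T \<and>
     uniquely_rooted S (Restr r S) \<and> balanced (Restr r S) \<and>
     (\<forall>n. \<exists>m. tree_level S (Restr r S) n \<subseteq> tree_level T r m) \<and>
     (\<forall>s\<in>S. aboveS (Restr r S) s \<noteq> {} \<longrightarrow>
        (\<forall>t\<in>imm_succ T r s. \<exists>!s'. s' \<in> imm_succ S (Restr r S) s \<and> (t, s') \<in> r))"

end

theory Submission
  imports Defs "HOL-Library.Ramsey"
begin

text \<open>
  Let \<open>f\<^sub>t\<close> be the indicator of \<open>A\<^sub>t\<close>, regarded as a vector of \<open>L\<^sup>2\<close>; the claim is a lower bound for the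
  inner products \<open>\<langle>f\<^sub>s, f\<^sub>t\<rangle>\<close>. For a sequence of events one would pass to a weak limit \<open>g\<close>. Its mean
  is at least \<open>\<epsilon>\<close>, so \<open>\<langle>g, g\<rangle> \<ge> \<epsilon>\<^sup>2\<close> by Cauchy-Schwarz, and the vectors of the sequence can be
  chosen one by one such that each has nearly the same inner products as \<open>g\<close> with those chosen before.
  In a strong subtree the nodes of one level have to be chosen simultaneously, on a common level of
  \<open>T\<close>, in many disjoint cones. The proof constructs a substitute for the weak limit that is adapted to
  this, by an extremal argument that rests on a partition property of trees.

  Call a set \<open>D\<close> of nodes dense along \<open>(w, L)\<close>, where \<open>w\<close> is a node and \<open>L\<close> an infinite set of levels,
  if above every \<open>u \<ge> w\<close> it has nodes at all but finitely many levels in \<open>L\<close>. If a dense set is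
  coloured with finitely many colours, some colour class is dense along some \<open>(w', L')\<close> with
  \<open>w' \<ge> w\<close> and \<open>L' \<subseteq> L\<close> (\<open>dense_along_colour\<close>). Consider the averages of vectors \<open>f\<^sub>t\<close> with \<open>t \<in> D\<close>
  above \<open>w\<close> at a common level in \<open>L\<close>, and choose \<open>(w, L, D)\<close> such that their least norm is almost as
  large as possible (\<open>near_extremal\<close>). Let \<open>g\<^sub>m\<close> be an average at level \<open>m\<close> of almost least norm. Every
  dense subset of \<open>D\<close> has, at suitable levels \<open>m\<close>, averages of almost this norm, and these are close to \<open>g\<^sub>m\<close> by the
  parallelogram law. Given \<open>k\<close> vectors for each level, take for the dense subset a class of nodes on
  which the inner products with these vectors are nearly constant: then these constants must be
  nearly the inner products with \<open>g\<^sub>m\<close>. It follows that above every \<open>u \<ge> w\<close>, at every large level \<open>m\<close>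
  in \<open>L\<close>, and for any \<open>k\<close> vectors, some \<open>f\<^sub>t\<close> has nearly the same inner products with them as \<open>g\<^sub>m\<close>
  (\<open>level_limit_exists\<close>).

  Since the vectors are arbitrary and may depend on \<open>m\<close>, they may include events chosen at the same
  level \<open>m\<close> in other cones. So nodes of level \<open>m\<close> can be chosen in finitely many cones one after
  another, with inner products close to \<open>\<langle>g\<^sub>m, g\<^sub>m\<rangle> \<ge> \<epsilon>\<^sup>2\<close> (\<open>same_level_selection\<close>). For nodes
  of different levels, Ramsey's theorem provides an infinite set of levels \<open>m\<close>, \<open>n\<close> for which
  \<open>\<langle>g\<^sub>m, g\<^sub>n\<rangle>\<close> is not much smaller than \<open>\<epsilon>\<^sup>2\<close>, and the pigeonhole principle maintains that all events chosen so far are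
  equally well correlated with \<open>g\<^sub>n\<close> for infinitely many \<open>n\<close> (\<open>extend_good_stage\<close>). Applying this
  repeatedly to the immediate successors of the nodes chosen last yields the strong subtree.
\<close>

section \<open>Averages and inner products on a probability space\<close>

text \<open>
  Midpoints take the place of arbitrary convex combinations: the parallelogram law compares two
  averages with their midpoint only, and the bounds below pass to midpoints.
\<close>

inductive_set midpoint_hull :: "('b \<Rightarrow> real) set \<Rightarrow> ('b \<Rightarrow> real) set"
  for X :: "('b \<Rightarrow> real) set" where
    base: "f \<in> X \<Longrightarrow> f \<in> midpoint_hull X"
  | mid: "f \<in> midpoint_hull X \<Longrightarrow> g \<in> midpoint_hull X \<Longrightarrow> (\<lambda>x. (f x + g x) / 2) \<in> midpoint_hull X"

lemma midpoint_hull_mono: "X \<subseteq> Y \<Longrightarrow> midpoint_hull X \<subseteq> midpoint_hull Y"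
proof
  fix f assume "X \<subseteq> Y" "f \<in> midpoint_hull X"
  from this(2,1) show "f \<in> midpoint_hull Y"
    by induction (auto intro: midpoint_hull.intros)
qed

lemma midpoint_hull_empty [simp]: "midpoint_hull {} = {}"
proof -
  have "False" if "f \<in> midpoint_hull {}" for f :: "'b \<Rightarrow> real"
    using that by induction auto
  then show ?thesis by blast
qed

context prob_space
begin

text \<open>
  All functions that occur are averages of indicators. With values in \<open>[0, 1]\<close> they are integrable
  together with their products, so the \<open>L\<^sup>2\<close> inner product can be computed on functions, without
  passing to equivalence classes.
\<close>

definition unit_funs :: "('a \<Rightarrow> real) set" where
  "unit_funs = {f \<in> borel_measurable M. \<forall>x. 0 \<le> f x \<and> f x \<le> 1}"

definition ip :: "('a \<Rightarrow> real) \<Rightarrow> ('a \<Rightarrow> real) \<Rightarrow> real" where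
  "ip f g = expectation (\<lambda>x. f x * g x)"

lemma ip_commute: "ip f g = ip g f"
  by (simp add: ip_def mult.commute)

lemma unit_funsD:
  assumes "f \<in> unit_funs"
  shows "f \<in> borel_measurable M" "0 \<le> f x" "f x \<le> 1"
  using assms by (auto simp: unit_funs_def)

lemma integrable_unit_fun: "f \<in> unit_funs \<Longrightarrow> integrable M f"
  by (rule integrable_const_bound[where B = 1]) (auto simp: unit_funs_def)

lemma mult_unit_funs: "f \<in> unit_funs \<Longrightarrow> g \<in> unit_funs \<Longrightarrow> (\<lambda>x. f x * g x) \<in> unit_funs"
  by (auto simp: unit_funs_def mult_le_one)

lemma integrable_ip: "f \<in> unit_funs \<Longrightarrow> g \<in> unit_funs \<Longrightarrow> integrable M (\<lambda>x. f x * g x)"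
  by (simp add: integrable_unit_fun mult_unit_funs)

lemma mid_unit_funs: "f \<in> unit_funs \<Longrightarrow> g \<in> unit_funs \<Longrightarrow> (\<lambda>x. (f x + g x) / 2) \<in> unit_funs"
proof -
  assume f: "f \<in> unit_funs" and g: "g \<in> unit_funs"
  have "0 \<le> (f x + g x) / 2" "(f x + g x) / 2 \<le> 1" for x
    using unit_funsD(2,3)[OF f, of x] unit_funsD(2,3)[OF g, of x] by auto
  moreover have "(\<lambda>x. (f x + g x) / 2) \<in> borel_measurable M"
    using unit_funsD(1)[OF f] unit_funsD(1)[OF g] by measurable
  ultimately show ?thesis unfolding unit_funs_def by blast
qed

lemma ip_nonneg: "f \<in> unit_funs \<Longrightarrow> g \<in> unit_funs \<Longrightarrow> 0 \<le> ip f g"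
  unfolding ip_def by (intro integral_nonneg_AE) (auto simp: unit_funsD)

lemma ip_le_1:
  assumes "f \<in> unit_funs" "g \<in> unit_funs"
  shows "ip f g \<le> 1"
proof -
  have "ip f g \<le> expectation (\<lambda>x. 1)"
    unfolding ip_def using assms mult_unit_funs[OF assms]
    by (intro integral_mono integrable_ip) (auto simp: unit_funs_def)
  then show ?thesis by (simp add: prob_space)
qed

lemma expectation_square_le:
  fixes X :: "'a \<Rightarrow> real"
  assumes "integrable M X" "integrable M (\<lambda>x. (X x)\<^sup>2)"
  shows "(expectation X)\<^sup>2 \<le> expectation (\<lambda>x. (X x)\<^sup>2)"
  using variance_eq[of X, OF assms] variance_positive[of X] by simp

text \<open>
  This is the inequality of Cauchy and Schwarz, in the form \<open>(E X)\<^sup>2 \<le> E (X\<^sup>2)\<close> applied to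
  \<open>X = f (g - h)\<close>; the factor \<open>f\<close> disappears because \<open>f\<^sup>2 \<le> 1\<close>.
\<close>

lemma ip_diff_le_L2_distance:
  assumes "f \<in> unit_funs" "g \<in> unit_funs" "h \<in> unit_funs"
  shows "\<bar>ip f g - ip f h\<bar> \<le> sqrt (expectation (\<lambda>x. (g x - h x)\<^sup>2))"
proof -
  have int: "integrable M (\<lambda>x. f x * (g x - h x))"
    using integrable_ip[OF assms(1,2)] integrable_ip[OF assms(1,3)] by (simp add: right_diff_distrib)
  have b: "\<bar>f x * (g x - h x)\<bar> \<le> \<bar>g x - h x\<bar>" "\<bar>g x - h x\<bar> \<le> 1" for x
    using unit_funsD(2,3)[OF assms(1), of x] unit_funsD(2,3)[OF assms(2), of x]
      unit_funsD(2,3)[OF assms(3), of x]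
    by (auto simp: abs_mult mult_left_le_one_le)
  have sq: "(f x * (g x - h x))\<^sup>2 \<le> (g x - h x)\<^sup>2" "(g x - h x)\<^sup>2 \<le> 1" for x
    using b[of x] by (auto simp: abs_le_square_iff[symmetric] abs_square_le_1)
  have m: "f \<in> borel_measurable M" "g \<in> borel_measurable M" "h \<in> borel_measurable M"
    using assms by (auto simp: unit_funs_def)
  have int2: "integrable M (\<lambda>x. (g x - h x)\<^sup>2)"
    using sq m by (intro integrable_const_bound[where B = 1]) auto
  have int1: "integrable M (\<lambda>x. (f x * (g x - h x))\<^sup>2)"
    using m order_trans[OF sq] by (intro integrable_const_bound[where B = 1]) auto
  have "(ip f g - ip f h)\<^sup>2 = (expectation (\<lambda>x. f x * (g x - h x)))\<^sup>2"
    unfolding ip_def using integrable_ip[OF assms(1,2)] integrable_ip[OF assms(1,3)]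
    by (simp add: right_diff_distrib)
  also have "\<dots> \<le> expectation (\<lambda>x. (f x * (g x - h x))\<^sup>2)"
    by (rule expectation_square_le[OF int int1])
  also have "\<dots> \<le> expectation (\<lambda>x. (g x - h x)\<^sup>2)"
    by (rule integral_mono[OF int1 int2]) (rule sq)
  finally have "(ip f g - ip f h)\<^sup>2 \<le> expectation (\<lambda>x. (g x - h x)\<^sup>2)" .
  from real_sqrt_le_mono[OF this] show ?thesis by simp
qed

lemma parallelogram:
  assumes g: "g \<in> unit_funs" and h: "h \<in> unit_funs"
  shows "expectation (\<lambda>x. (g x - h x)\<^sup>2) = 2 * ip g g + 2 * ip h h -
    4 * ip (\<lambda>x. (g x + h x) / 2) (\<lambda>x. (g x + h x) / 2)"
proof -
  have m: "(\<lambda>x. (g x + h x) / 2) \<in> unit_funs" by (rule mid_unit_funs[OF g h])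
  have lin: "expectation (\<lambda>x. 2 * a x + 2 * b x - 4 * c x) =
      2 * expectation a + 2 * expectation b - 4 * expectation c"
    if "integrable M a" "integrable M b" "integrable M c" for a b c :: "'a \<Rightarrow> real"
    using that by simp
  have "expectation (\<lambda>x. (g x - h x)\<^sup>2) = expectation (\<lambda>x. 2 * (g x * g x) + 2 * (h x * h x) -
      4 * ((g x + h x) / 2 * ((g x + h x) / 2)))"
    by (intro Bochner_Integration.integral_cong refl) (simp add: power2_eq_square algebra_simps)
  also have "\<dots> = 2 * ip g g + 2 * ip h h - 4 * ip (\<lambda>x. (g x + h x) / 2) (\<lambda>x. (g x + h x) / 2)"
    unfolding ip_def
    by (rule lin) (rule integrable_ip[OF g g] integrable_ip[OF h h] integrable_ip[OF m m])+
  finally show ?thesis .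
qed

lemma midpoint_hull_unit_funs: "X \<subseteq> unit_funs \<Longrightarrow> midpoint_hull X \<subseteq> unit_funs"
proof
  fix f assume "X \<subseteq> unit_funs" "f \<in> midpoint_hull X"
  from this(2,1) show "f \<in> unit_funs" by induction (auto intro: mid_unit_funs)
qed

lemma ip_mid:
  assumes "F \<in> unit_funs" "f \<in> unit_funs" "g \<in> unit_funs"
  shows "ip F (\<lambda>x. (f x + g x) / 2) = (ip F f + ip F g) / 2"
proof -
  have "ip F (\<lambda>x. (f x + g x) / 2) = expectation (\<lambda>x. (F x * f x + F x * g x) / 2)"
    by (simp add: ip_def algebra_simps)
  also have "\<dots> = (ip F f + ip F g) / 2"
    using integrable_ip[OF assms(1,2)] integrable_ip[OF assms(1,3)] by (simp add: ip_def)
  finally show ?thesis .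
qed

text \<open>
  If a vector \<open>F\<close> has nearly constant inner product with the elements of \<open>X\<close>, then it has nearly
  the same inner product with every average of them. This is how information about single events is
  compared with information about their averages.
\<close>

lemma midpoint_hull_ip_bounds:
  assumes "g \<in> midpoint_hull X" "X \<subseteq> unit_funs" "F \<in> unit_funs"
    and "\<And>f. f \<in> X \<Longrightarrow> a \<le> ip F f \<and> ip F f \<le> b"
  shows "a \<le> ip F g \<and> ip F g \<le> b"
  using assms(1)
proof induction
  case (base f)
  then show ?case using assms(4) by blast
next
  case (mid f g)
  then have "f \<in> unit_funs" "g \<in> unit_funs" using midpoint_hull_unit_funs[OF assms(2)] by auto
  with mid.IH show ?case by (simp add: ip_mid[OF assms(3)])
qed

lemma one_unit_funs: "(\<lambda>x. 1) \<in> unit_funs"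
  by (simp add: unit_funs_def)

text \<open>
  If all pairs had inner product below \<open>e\<^sup>2 - \<kappa>\<close>, then the sum \<open>G\<close> of \<open>N\<close> of the functions would
  satisfy \<open>(N e)\<^sup>2 \<le> (E G)\<^sup>2 \<le> E (G\<^sup>2) \<le> N\<^sup>2 (e\<^sup>2 - \<kappa>) + N\<close>, where the last summand
  bounds the diagonal; this fails once \<open>N\<close> exceeds \<open>1 / \<kappa>\<close>.
\<close>

lemma infinite_sequence_correlated:
  assumes inf: "infinite (L :: nat set)" and "0 < \<kappa>" and "0 \<le> e"
    and g: "\<And>m. m \<in> L \<Longrightarrow> g m \<in> unit_funs \<and> e \<le> expectation (g m)"
  shows "\<exists>m\<in>L. \<exists>n\<in>L. m \<noteq> n \<and> e\<^sup>2 - \<kappa> \<le> ip (g m) (g n)"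
proof (rule ccontr)
  assume neg: "\<not> ?thesis"
  then have small: "ip (g m) (g n) \<le> e\<^sup>2 - \<kappa>" if "m \<in> L" "n \<in> L" "m \<noteq> n" for m n
    using that by (meson linear)
  obtain N :: nat where N: "1 / \<kappa> < N" using reals_Archimedean2 by blast
  obtain K where K: "K \<subseteq> L" "finite K" "card K = N"
    using infinite_arbitrarily_large[OF inf] by blast
  have N1: "1 < \<kappa> * N" using N assms(2) by (simp add: field_simps)
  have N0: "0 < N" using N1 by (cases N) auto
  have gK: "g m \<in> unit_funs" "e \<le> expectation (g m)" if "m \<in> K" for m
    using g K that by auto
  have ig: "integrable M (g m)" if "m \<in> K" for m
    using gK(1)[OF that] by (rule integrable_unit_fun)
  have igg: "integrable M (\<lambda>x. g m x * g n x)" if "m \<in> K" "n \<in> K" for m n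
    using gK(1)[OF that(1)] gK(1)[OF that(2)] by (rule integrable_ip)
  define G where "G x = (\<Sum>m\<in>K. g m x)" for x
  have G_sq: "(G x)\<^sup>2 = (\<Sum>m\<in>K. \<Sum>n\<in>K. g m x * g n x)" for x
    by (simp add: G_def power2_eq_square sum_product)
  have iG: "integrable M G" unfolding G_def using ig by (intro Bochner_Integration.integrable_sum)
  have iG2: "integrable M (\<lambda>x. (G x)\<^sup>2)"
    unfolding G_sq using igg by (intro Bochner_Integration.integrable_sum)
  have "N * e = (\<Sum>m\<in>K. e)" using K(3) by simp
  also have "\<dots> \<le> (\<Sum>m\<in>K. expectation (g m))" using gK(2) by (rule sum_mono)
  also have "\<dots> = expectation G" unfolding G_def using ig by (simp add: Bochner_Integration.integral_sum)
  finally have "(N * e)\<^sup>2 \<le> (expectation G)\<^sup>2" using assms(3) by (intro power_mono) auto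
  also have "\<dots> \<le> expectation (\<lambda>x. (G x)\<^sup>2)" by (rule expectation_square_le[OF iG iG2])
  also have "\<dots> = (\<Sum>m\<in>K. \<Sum>n\<in>K. ip (g m) (g n))"
    unfolding G_sq ip_def using igg
    by (simp add: Bochner_Integration.integral_sum Bochner_Integration.integrable_sum)
  also have "\<dots> \<le> (\<Sum>m\<in>K. \<Sum>n\<in>K. (e\<^sup>2 - \<kappa>) + (if n = m then 1 - (e\<^sup>2 - \<kappa>) else 0))"
  proof (intro sum_mono)
    fix m n assume mn: "m \<in> K" "n \<in> K"
    show "ip (g m) (g n) \<le> (e\<^sup>2 - \<kappa>) + (if n = m then 1 - (e\<^sup>2 - \<kappa>) else 0)"
      using small[of m n] mn K(1) ip_le_1[OF gK(1)[OF mn(1)] gK(1)[OF mn(2)]] by auto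
  qed
  also have "\<dots> = N * (N * (e\<^sup>2 - \<kappa>) + (1 - (e\<^sup>2 - \<kappa>)))"
    using K by (simp add: sum.distrib)
  finally have "N * (N * e\<^sup>2) \<le> N * (N * (e\<^sup>2 - \<kappa>) + (1 - (e\<^sup>2 - \<kappa>)))"
    by (simp add: power2_eq_square algebra_simps)
  then have "N * e\<^sup>2 \<le> N * (e\<^sup>2 - \<kappa>) + (1 - (e\<^sup>2 - \<kappa>))" using N0 by simp
  then have le: "\<kappa> * N \<le> 1 - (e\<^sup>2 - \<kappa>)" by (simp add: algebra_simps)
  obtain m where m: "m \<in> L" using inf infinite_imp_nonempty by blast
  have "infinite (L - {m})" using inf by simp
  then obtain n where n: "n \<in> L" "n \<noteq> m" using infinite_imp_nonempty by blast
  have "0 \<le> e\<^sup>2 - \<kappa>"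
    using small[OF m n(1)] n(2) ip_nonneg[of "g m" "g n"] g m n by force
  with le N1 show False by simp
qed

text \<open>
  Ramsey's theorem for pairs: the homogeneous set cannot consist of badly correlated pairs, by the
  preceding lemma.
\<close>

lemma infinite_subsequence_correlated:
  assumes inf: "infinite (L :: nat set)" and "0 < \<kappa>" and "0 \<le> e"
    and g: "\<And>m. m \<in> L \<Longrightarrow> g m \<in> unit_funs \<and> e \<le> expectation (g m)"
  shows "\<exists>L'\<subseteq>L. infinite L' \<and> (\<forall>m\<in>L'. \<forall>n\<in>L'. m \<noteq> n \<longrightarrow> e\<^sup>2 - \<kappa> \<le> ip (g m) (g n))"
proof -
  define col :: "nat set \<Rightarrow> nat" where
    "col P = (if \<exists>m n. P = {m, n} \<and> m \<noteq> n \<and> e\<^sup>2 - \<kappa> \<le> ip (g m) (g n) then 0 else 1)" for P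
  have col: "col {m, n} = 0 \<longleftrightarrow> e\<^sup>2 - \<kappa> \<le> ip (g m) (g n)" if "m \<noteq> n" for m n
    using that ip_commute by (auto simp: col_def doubleton_eq_iff)
  have "\<forall>x\<in>L. \<forall>y\<in>L. x \<noteq> y \<longrightarrow> col {x, y} < 2" by (simp add: col_def)
  from Ramsey2[OF inf this] obtain L' t where
    L': "L' \<subseteq> L" "infinite L'" "\<forall>x\<in>L'. \<forall>y\<in>L'. x \<noteq> y \<longrightarrow> col {x, y} = t" by blast
  obtain m n where mn: "m \<in> L'" "n \<in> L'" "m \<noteq> n" "e\<^sup>2 - \<kappa> \<le> ip (g m) (g n)"
    using infinite_sequence_correlated[OF L'(2) assms(2,3), of g] g L'(1) by blast
  have "t = 0" using L'(3)[rule_format, OF mn(1-3)] col[OF mn(3)] mn(4) by simp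
  then have "e\<^sup>2 - \<kappa> \<le> ip (g m) (g n)" if "m \<in> L'" "n \<in> L'" "m \<noteq> n" for m n
    using L'(3)[rule_format, OF that] col[OF that(3)] \<open>t = 0\<close> by simp
  with L'(1,2) show ?thesis by (intro exI[of _ L']) blast
qed

end

section \<open>Levels and cones of a homogeneous tree\<close>

locale hom_tree =
  fixes T :: "'a set" and r :: "'a rel"
  assumes hom: "homogeneous_tree T r"
begin

lemma tree: "is_tree T r"
  using hom by (simp add: homogeneous_tree_def)

lemma r_carrier: "(s, t) \<in> r \<Longrightarrow> s \<in> T \<and> t \<in> T"
  using tree partial_order_onD(4)[of T r] by (auto simp: is_tree_def)

lemma r_refl: "t \<in> T \<Longrightarrow> (t, t) \<in> r"
  using tree partial_order_onD(1)[of T r] by (auto simp: is_tree_def refl_on_def)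

lemma r_trans: "(s, t) \<in> r \<Longrightarrow> (t, u) \<in> r \<Longrightarrow> (s, u) \<in> r"
  using tree partial_order_onD(2)[of T r] by (auto simp: is_tree_def dest: transD)

lemma r_antisym: "(s, t) \<in> r \<Longrightarrow> (t, s) \<in> r \<Longrightarrow> s = t"
  using tree partial_order_onD(3)[of T r] by (auto simp: is_tree_def dest: antisymD)

lemma finite_underS: "t \<in> T \<Longrightarrow> finite (underS r t)"
  using tree by (simp add: is_tree_def)

lemma below_comparable:
  assumes "(s, u) \<in> r" "(t, u) \<in> r"
  shows "(s, t) \<in> r \<or> (t, s) \<in> r"
proof (cases "s = u \<or> t = u")
  case False
  have "u \<in> T" using assms r_carrier by blast
  then have "underS r u \<in> Chains r" using tree by (simp add: is_tree_def)
  with False assms show ?thesis by (auto simp: Chains_def underS_def)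
qed (use assms in auto)

lemma length_less:
  assumes "(s, t) \<in> r" "s \<noteq> t"
  shows "tree_length r s < tree_length r t"
  unfolding tree_length_def
proof (rule psubset_card_mono)
  show "finite (underS r t)" using assms(1) r_carrier finite_underS by blast
  have "underS r s \<subseteq> underS r t"
    using assms r_trans r_antisym by (fastforce simp: underS_def)
  moreover have "s \<in> underS r t" "s \<notin> underS r s" using assms by (auto simp: underS_def)
  ultimately show "underS r s \<subset> underS r t" by blast
qed

lemma length_le: "(s, t) \<in> r \<Longrightarrow> tree_length r s \<le> tree_length r t"
  using length_less[of s t] by (cases "s = t") auto

lemma below_same_length_eq:
  assumes "(s, u) \<in> r" "(t, u) \<in> r" "tree_length r s = tree_length r t"
  shows "s = t"
  using below_comparable[OF assms(1,2)] length_less[of s t] length_less[of t s] assms(3) by auto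

lemma exists_longest:
  assumes "finite C" "C \<noteq> {}"
  shows "\<exists>c\<in>C. \<forall>d\<in>C. tree_length r d \<le> tree_length r c"
proof -
  have "Max (tree_length r ` C) \<in> tree_length r ` C"
    using assms by (intro Max_in) auto
  then obtain c where "c \<in> C" "tree_length r c = Max (tree_length r ` C)" by auto
  then show ?thesis using assms(1) by (intro bexI[of _ c]) auto
qed

definition cone_level :: "'a \<Rightarrow> nat \<Rightarrow> 'a set" where
  "cone_level u m = {t \<in> tree_level T r m. (u, t) \<in> r}"

lemma cone_levelD:
  assumes "t \<in> cone_level u m"
  shows "t \<in> T" "tree_length r t = m" "(u, t) \<in> r"
  using assms by (auto simp: cone_level_def tree_level_def)

lemma cone_level_mono: "(u, v) \<in> r \<Longrightarrow> cone_level v m \<subseteq> cone_level u m"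
  using r_trans by (auto simp: cone_level_def)

lemma card_imm_succ: "\<exists>b\<ge>2. \<forall>t\<in>T. card (imm_succ T r t) = b"
  using hom by (simp add: homogeneous_tree_def)

lemma finite_imm_succ: "t \<in> T \<Longrightarrow> finite (imm_succ T r t)"
  using card_imm_succ by (metis card.infinite not_numeral_le_zero)

lemma imm_succ_nonempty: "t \<in> T \<Longrightarrow> imm_succ T r t \<noteq> {}"
  using card_imm_succ by (metis card.empty not_numeral_le_zero)

lemma imm_succD:
  assumes "s \<in> imm_succ T r t"
  shows "s \<in> T" "(t, s) \<in> r" "tree_length r s = Suc (tree_length r t)"
  using assms by (auto simp: imm_succ_def)

lemma cone_level_nonempty:
  assumes "u \<in> T" "tree_length r u \<le> m"
  shows "cone_level u m \<noteq> {}"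
  using assms(2)
proof (induction m rule: dec_induct)
  case base
  then show ?case using assms(1) r_refl by (auto simp: cone_level_def tree_level_def)
next
  case (step m)
  then obtain t where t: "t \<in> cone_level u m" by blast
  then obtain s where "s \<in> imm_succ T r t" using imm_succ_nonempty cone_levelD by blast
  then have "s \<in> cone_level u (Suc m)"
    using cone_levelD[OF t] imm_succD[of s t] r_trans by (auto simp: cone_level_def tree_level_def)
  then show ?case by blast
qed

lemma root: obtains x where "x \<in> T" "tree_level T r 0 = {x}"
proof -
  have "card (tree_level T r 0) = 1"
    using hom by (simp add: homogeneous_tree_def uniquely_rooted_def)
  then obtain x where "tree_level T r 0 = {x}" using card_1_singletonE by metis
  then show thesis using that by (auto simp: tree_level_def)
qed

lemma imm_pred:
  assumes "t \<in> T" "tree_length r t = Suc n"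
  obtains p where "p \<in> tree_level T r n" "t \<in> imm_succ T r p"
proof -
  have fin: "finite (underS r t)" using finite_underS assms by blast
  have ne: "underS r t \<noteq> {}" using assms(2) by (auto simp: tree_length_def)
  obtain p where p: "p \<in> underS r t" "\<And>q. q \<in> underS r t \<Longrightarrow> tree_length r q \<le> tree_length r p"
    using exists_longest[OF fin ne] by blast
  have pt: "(p, t) \<in> r" "p \<noteq> t" using p(1) by (auto simp: underS_def)
  have "underS r t = insert p (underS r p)"
  proof (intro equalityI subsetI)
    fix q assume q: "q \<in> underS r t"
    then have qt: "(q, t) \<in> r" by (auto simp: underS_def)
    show "q \<in> insert p (underS r p)"
      using below_comparable[OF qt pt(1)] p(2)[OF q] length_less[of p q]
      by (auto simp: underS_def)
  next
    fix q assume "q \<in> insert p (underS r p)"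
    then show "q \<in> underS r t"
      using pt p(1) r_trans r_antisym by (auto simp: underS_def)
  qed
  moreover have "p \<notin> underS r p" by (simp add: underS_def)
  moreover have "finite (underS r p)" using finite_underS pt r_carrier by blast
  ultimately have "tree_length r t = Suc (tree_length r p)" by (simp add: tree_length_def)
  with assms pt r_carrier show thesis
    by (intro that[of p]) (auto simp: tree_level_def imm_succ_def)
qed

lemma finite_level: "finite (tree_level T r n)"
proof (induction n)
  case 0
  show ?case by (rule root) simp
next
  case (Suc n)
  have "tree_level T r (Suc n) \<subseteq> (\<Union>p\<in>tree_level T r n. imm_succ T r p)"
  proof
    fix t assume "t \<in> tree_level T r (Suc n)"
    then have "t \<in> T" "tree_length r t = Suc n" by (auto simp: tree_level_def)
    then show "t \<in> (\<Union>p\<in>tree_level T r n. imm_succ T r p)"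
      by (rule imm_pred) blast
  qed
  moreover have "finite (\<Union>p\<in>tree_level T r n. imm_succ T r p)"
    using Suc finite_imm_succ by (auto simp: tree_level_def)
  ultimately show ?case using finite_subset by blast
qed

lemma finite_cone_level: "finite (cone_level u m)"
  using finite_level by (simp add: cone_level_def)

text \<open>
  A recipe for strong subtrees of infinite height: prescribe the levels \<open>X n\<close> one after another,
  each inside one level of \<open>T\<close>, with exactly one node of \<open>X (n + 1)\<close> above each immediate successor
  of a node of \<open>X n\<close>. The predecessors of a node form a chain with one node in each smaller \<open>X i\<close>,
  so \<open>X n\<close> is the \<open>n\<close>-th level of the union. The union is balanced because a finite chain always
  extends upwards, so that all maximal chains are countably infinite.
\<close>

lemma strong_subtree_of_level_sequence:
  assumes lev: "\<And>n. X n \<subseteq> tree_level T r (lv n)"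
    and mono: "strict_mono lv"
    and root: "X 0 = {x0}"
    and below: "\<And>n y. y \<in> X (Suc n) \<Longrightarrow> \<exists>x\<in>X n. (x, y) \<in> r"
    and succ: "\<And>n x t. x \<in> X n \<Longrightarrow> t \<in> imm_succ T r x \<Longrightarrow> \<exists>!y. y \<in> X (Suc n) \<and> (t, y) \<in> r"
  shows "strong_subtree (\<Union>n. X n) T r"
    and "tree_height (\<Union>n. X n) (Restr r (\<Union>n. X n)) = \<infinity>"
proof -
  define S where "S = (\<Union>n. X n)"
  define R where "R = Restr r S"
  have XT: "X n \<subseteq> T" for n using lev[of n] by (auto simp: tree_level_def)
  have XS: "X n \<subseteq> S" for n by (auto simp: S_def)
  have ST: "S \<subseteq> T" using XT by (auto simp: S_def)
  have len: "tree_length r x = lv n" if "x \<in> X n" for x n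
    using lev[of n] that by (auto simp: tree_level_def)
  have idx_less: "i < n" if "x \<in> X i" "y \<in> X n" "(x, y) \<in> r" "x \<noteq> y" for x y i n
    using length_less[OF that(3,4)] len that(1,2) strict_mono_less[OF mono] by auto
  have X_ne: "X n \<noteq> {}" for n
  proof (induction n)
    case 0
    then show ?case using root by simp
  next
    case (Suc n)
    then obtain x where x: "x \<in> X n" by blast
    then obtain t where "t \<in> imm_succ T r x" using imm_succ_nonempty XT by blast
    then show ?case using succ[OF x] by blast
  qed
  have pred_ex: "\<exists>x\<in>X i. (x, y) \<in> r" if "y \<in> X n" "i \<le> n" for i n y
    using that(2,1)
  proof (induction n arbitrary: y rule: dec_induct)
    case base
    then show ?case using XT r_refl by blast
  next
    case (step n)
    then obtain z where "z \<in> X n" "(z, y) \<in> r" using below by blast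
    with step.IH show ?case using r_trans by blast
  qed
  have len_S: "tree_length R y = n" if y: "y \<in> X n" for y n
  proof -
    define p where "p i = (SOME x. x \<in> X i \<and> (x, y) \<in> r)" for i
    have p: "p i \<in> X i" "(p i, y) \<in> r" if "i < n" for i
      using someI_ex[of "\<lambda>x. x \<in> X i \<and> (x, y) \<in> r"] pred_ex[OF y, of i] that
      unfolding p_def by auto
    have "bij_betw p {..<n} (underS R y)"
      unfolding bij_betw_def
    proof
      show "inj_on p {..<n}"
      proof (rule inj_onI)
        fix i j assume "i \<in> {..<n}" "j \<in> {..<n}" "p i = p j"
        then have "lv i = lv j" using len[OF p(1)[of i]] len[OF p(1)[of j]] by simp
        then show "i = j" using strict_mono_eq[OF mono] by simp
      qed
      show "p ` {..<n} = underS R y"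
      proof (intro equalityI subsetI)
        fix x assume "x \<in> p ` {..<n}"
        then obtain i where i: "i < n" "x = p i" by auto
        have "x \<noteq> y"
          using len[OF p(1)[OF i(1)]] len[OF y] i strict_mono_eq[OF mono, of i n] by auto
        then show "x \<in> underS R y"
          using p[OF i(1)] i(2) y XS[of i] XS[of n] by (auto simp: underS_def R_def)
      next
        fix x assume "x \<in> underS R y"
        then have x: "x \<noteq> y" "(x, y) \<in> r" "x \<in> S" by (auto simp: underS_def R_def)
        then obtain i where i: "x \<in> X i" by (auto simp: S_def)
        have "i < n" using idx_less[OF i y x(2,1)] .
        moreover have "x = p i"
          using below_same_length_eq[OF x(2) p(2)[OF \<open>i < n\<close>]]
            len[OF i] len[OF p(1)[OF \<open>i < n\<close>]] by simp
        ultimately show "x \<in> p ` {..<n}" by auto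
      qed
    qed
    from bij_betw_same_card[OF this] show ?thesis by (simp add: tree_length_def)
  qed
  have level_S: "tree_level S R n = X n" for n
    using len_S by (auto simp: tree_level_def S_def)
  have imm_S: "y \<in> imm_succ S R x \<longleftrightarrow> y \<in> X (Suc n) \<and> (x, y) \<in> r" if x: "x \<in> X n" for x y n
  proof -
    have "y \<in> imm_succ S R x \<longleftrightarrow> y \<in> tree_level S R (Suc n) \<and> (x, y) \<in> r"
      using len_S[OF x] x XS by (auto simp: imm_succ_def tree_level_def R_def)
    then show ?thesis by (simp add: level_S)
  qed
  have chain_infinite: "infinite C" if C: "maximal_chain R C" for C
  proof
    assume fin: "finite C"
    have chain: "C \<in> Chains R" and max: "\<And>D. D \<in> Chains R \<Longrightarrow> C \<subseteq> D \<Longrightarrow> D = C"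
      using C by (auto simp: maximal_chain_def)
    have comp: "\<And>a b. a \<in> C \<Longrightarrow> b \<in> C \<Longrightarrow> (a, b) \<in> R \<or> (b, a) \<in> R"
      using chain by (auto simp: Chains_def)
    have CS: "C \<subseteq> S" using comp by (auto simp: R_def)
    have ex_strict: "\<exists>z\<in>S. z \<notin> C \<and> (\<forall>c\<in>C. (c, z) \<in> R)"
    proof (cases "C = {}")
      case True
      then show ?thesis using X_ne[of 0] XS[of 0] by auto
    next
      case False
      obtain c where c: "c \<in> C" "\<And>d. d \<in> C \<Longrightarrow> tree_length r d \<le> tree_length r c"
        using exists_longest[OF fin False] by blast
      have top: "(d, c) \<in> R" if "d \<in> C" for d
        using comp[OF that c(1)] c(2)[OF that] length_less[of c d] by (auto simp: R_def)
      obtain n where n: "c \<in> X n" using c(1) CS by (auto simp: S_def)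
      obtain t where t: "t \<in> imm_succ T r c" using imm_succ_nonempty XT n by blast
      obtain z where z: "z \<in> X (Suc n)" "(t, z) \<in> r" using succ[OF n t] by blast
      have cz: "(c, z) \<in> r" using imm_succD[OF t] z r_trans by blast
      have "(d, z) \<in> R" if "d \<in> C" for d
        using top[OF that] cz r_trans z(1) XS[of "Suc n"] by (auto simp: R_def)
      moreover have "z \<notin> C"
        using c(2)[of z] imm_succD(3)[OF t] length_le[OF z(2)] by force
      ultimately show ?thesis using z(1) XS by blast
    qed
    then obtain z where z: "z \<in> S" "z \<notin> C" "\<forall>c\<in>C. (c, z) \<in> R" by blast
    have "(z, z) \<in> R" using z(1) ST r_refl by (auto simp: R_def)
    then have "insert z C \<in> Chains R" using z(3) comp by (auto simp: Chains_def)
    with max z(2) show False by blast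
  qed
  have chain_countable: "countable C" if C: "maximal_chain R C" for C
  proof (rule countableI)
    have "\<And>a b. a \<in> C \<Longrightarrow> b \<in> C \<Longrightarrow> (a, b) \<in> r \<or> (b, a) \<in> r"
      using C by (auto simp: maximal_chain_def Chains_def R_def)
    then show "inj_on (tree_length r) C"
      using length_less by (intro inj_onI) fastforce
  qed
  have chain_eqpoll: "(UNIV :: nat set) \<approx> C" if "maximal_chain R C" for C
    unfolding eqpoll_def
    using bij_betw_from_nat_into[OF chain_countable[OF that] chain_infinite[OF that]] by blast
  have "balanced R"
    unfolding balanced_def
    using chain_eqpoll eqpoll_trans[OF eqpoll_sym] by blast
  moreover have "uniquely_rooted S R"
    unfolding uniquely_rooted_def level_S root by simp
  moreover have "\<exists>!s'. s' \<in> imm_succ S R s \<and> (t, s') \<in> r"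
    if s: "s \<in> S" and t: "t \<in> imm_succ T r s" for s t
  proof -
    obtain n where n: "s \<in> X n" using s by (auto simp: S_def)
    have "s' \<in> imm_succ S R s \<and> (t, s') \<in> r \<longleftrightarrow> s' \<in> X (Suc n) \<and> (t, s') \<in> r" for s'
      using imm_S[OF n] imm_succD(2)[OF t] r_trans by blast
    then show ?thesis using succ[OF n t] by simp
  qed
  ultimately have "strong_subtree S T r"
    unfolding strong_subtree_def R_def[symmetric] level_S using ST lev by blast
  moreover have "tree_height S R = \<infinity>"
    unfolding tree_height_def level_S using X_ne by simp
  ultimately show "strong_subtree (\<Union>n. X n) T r"
    "tree_height (\<Union>n. X n) (Restr r (\<Union>n. X n)) = \<infinity>"
    unfolding R_def S_def by auto
qed

section \<open>Sets of nodes that are dense along an infinite set of levels\<close>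

text \<open>
  The pair \<open>(w, L)\<close> is a condition that may later be strengthened, by moving \<open>w\<close> upwards and
  thinning out \<open>L\<close>. Demanding that \<open>D\<close> meets a cone at almost all levels of the same set \<open>L\<close>, for
  all cones above \<open>w\<close>, synchronises the cones: this is what later allows nodes of one common level
  to be chosen in several cones.
\<close>

definition dense_along :: "'a \<Rightarrow> nat set \<Rightarrow> 'a set \<Rightarrow> bool" where
  "dense_along w L D \<longleftrightarrow> w \<in> T \<and> infinite L \<and>
     (\<forall>u. (w, u) \<in> r \<longrightarrow> finite {m \<in> L. D \<inter> cone_level u m = {}})"

lemma dense_along_T:
  assumes "w \<in> T" "infinite L"
  shows "dense_along w L T"
  unfolding dense_along_def
proof (intro conjI allI impI)
  fix u assume "(w, u) \<in> r"
  then have u: "u \<in> T" using r_carrier by blast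
  have "{m \<in> L. T \<inter> cone_level u m = {}} \<subseteq> {..<tree_length r u}"
  proof
    fix m assume "m \<in> {m \<in> L. T \<inter> cone_level u m = {}}"
    then have "cone_level u m = {}" by (auto simp: cone_level_def tree_level_def)
    then show "m \<in> {..<tree_length r u}" using cone_level_nonempty[OF u, of m] by force
  qed
  then show "finite {m \<in> L. T \<inter> cone_level u m = {}}" using finite_subset by blast
qed (use assms in auto)

lemma dense_along_refine:
  assumes "dense_along w L D" "(w, u) \<in> r" "L' \<subseteq> L" "infinite L'"
  shows "dense_along u L' D"
  unfolding dense_along_def
proof (intro conjI allI impI)
  show "u \<in> T" using assms(2) r_carrier by blast
  fix v assume "(u, v) \<in> r"
  then have "finite {m \<in> L. D \<inter> cone_level v m = {}}"
    using assms(1,2) r_trans unfolding dense_along_def by blast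
  then show "finite {m \<in> L'. D \<inter> cone_level v m = {}}"
    by (rule rev_finite_subset) (use assms(3) in auto)
qed (rule assms(4))

text \<open>
  If \<open>D1\<close> is not dense, then there are a cone above \<open>w\<close> and infinitely many levels in \<open>L\<close> at which
  \<open>D1\<close> misses the cone. Along these levels and above this cone, all of \<open>D\<close> lies in \<open>D2\<close>.
\<close>

lemma dense_along_Un:
  assumes dense: "dense_along w L D" and D: "D \<subseteq> D1 \<union> D2"
  shows "\<exists>w' L'. (w, w') \<in> r \<and> L' \<subseteq> L \<and> (dense_along w' L' D1 \<or> dense_along w' L' D2)"
proof (cases "dense_along w L D1")
  case True
  then show ?thesis using r_refl unfolding dense_along_def by blast
next
  case False
  then obtain u where u: "(w, u) \<in> r" "infinite {m \<in> L. D1 \<inter> cone_level u m = {}}"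
    using dense unfolding dense_along_def by blast
  define L' where "L' = {m \<in> L. D1 \<inter> cone_level u m = {}}"
  have "dense_along u L' D2"
    unfolding dense_along_def
  proof (intro conjI allI impI)
    show "u \<in> T" using u(1) r_carrier by blast
    show "infinite L'" using u(2) by (simp add: L'_def)
    fix v assume v: "(u, v) \<in> r"
    then have fin: "finite {m \<in> L. D \<inter> cone_level v m = {}}"
      using dense u(1) r_trans unfolding dense_along_def by blast
    have "{m \<in> L'. D2 \<inter> cone_level v m = {}} \<subseteq> {m \<in> L. D \<inter> cone_level v m = {}}"
      using cone_level_mono[OF v] D unfolding L'_def by blast
    then show "finite {m \<in> L'. D2 \<inter> cone_level v m = {}}" using fin finite_subset by blast
  qed
  moreover have "L' \<subseteq> L" by (auto simp: L'_def)
  ultimately show ?thesis using u(1) by blast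
qed

lemma dense_along_colour:
  assumes "finite C" "dense_along w L D" "\<And>t. t \<in> D \<Longrightarrow> c t \<in> C"
  shows "\<exists>i\<in>C. \<exists>w' L'. (w, w') \<in> r \<and> L' \<subseteq> L \<and> dense_along w' L' {t \<in> D. c t = i}"
  using assms
proof (induction C arbitrary: w L D rule: finite_induct)
  case empty
  then have "D = {}" by auto
  then show ?case using empty.prems(1) r_refl by (auto simp: dense_along_def)
next
  case (insert i C)
  have "D \<subseteq> {t \<in> D. c t = i} \<union> {t \<in> D. c t \<in> C}" using insert.prems(2) by blast
  from dense_along_Un[OF insert.prems(1) this] obtain w' L' where
    w': "(w, w') \<in> r" "L' \<subseteq> L" and
    or: "dense_along w' L' {t \<in> D. c t = i} \<or> dense_along w' L' {t \<in> D. c t \<in> C}" by blast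
  from or show ?case
  proof
    assume "dense_along w' L' {t \<in> D. c t \<in> C}"
    from insert.IH[OF this] obtain j w'' L'' where
      *: "j \<in> C" "(w', w'') \<in> r" "L'' \<subseteq> L'" "dense_along w'' L'' {t \<in> {t \<in> D. c t \<in> C}. c t = j}"
      by blast
    have "{t \<in> {t \<in> D. c t \<in> C}. c t = j} = {t \<in> D. c t = j}" using *(1) by auto
    then have "dense_along w'' L'' {t \<in> D. c t = j}" using *(4) by simp
    moreover have "(w, w'') \<in> r" by (rule r_trans[OF w'(1) *(2)])
    moreover have "L'' \<subseteq> L" using *(3) w'(2) by (rule order_trans)
    ultimately show ?thesis using *(1) by blast
  next
    assume "dense_along w' L' {t \<in> D. c t = i}"
    with w' show ?thesis by blast
  qed
qed

end

section \<open>Vectors that approximate every level of a cone\<close>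

locale tree_events = hom_tree T r + prob_space M
  for T :: "'a set" and r :: "'a rel" and M :: "'b measure" +
  fixes A :: "'a \<Rightarrow> 'b set" and \<epsilon> :: real
  assumes events: "\<And>t. t \<in> T \<Longrightarrow> A t \<in> sets M"
    and eps_pos: "0 < \<epsilon>"
    and prob_ge: "\<And>t. t \<in> T \<Longrightarrow> \<epsilon> \<le> measure M (A t)"
begin

definition ev :: "'a \<Rightarrow> 'b \<Rightarrow> real" where
  "ev t = indicator (A t)"

lemma ev_unit_funs: "t \<in> T \<Longrightarrow> ev t \<in> unit_funs"
  using events by (auto simp: ev_def unit_funs_def indicator_def)

lemma ip_ev:
  assumes "s \<in> T" "t \<in> T"
  shows "ip (ev s) (ev t) = measure M (A s \<inter> A t)"
proof -
  have "ip (ev s) (ev t) = expectation (indicator (A s \<inter> A t))"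
    unfolding ip_def ev_def by (intro Bochner_Integration.integral_cong refl)
      (auto simp: indicator_def)
  also have "\<dots> = measure M (A s \<inter> A t)"
    using events[OF assms(1)] events[OF assms(2)] sets.sets_into_space
    by (simp add: Int_absorb2 le_infI1)
  finally show ?thesis .
qed

lemma ip_one: "ip (\<lambda>x. 1) f = expectation f"
  by (simp add: ip_def)

text \<open>
  Averages are taken within a single level, since the vectors against which they are tested will be
  allowed to depend on the level.
\<close>

definition avgs :: "'a set \<Rightarrow> 'a \<Rightarrow> nat \<Rightarrow> ('b \<Rightarrow> real) set" where
  "avgs D w m = midpoint_hull (ev ` (D \<inter> cone_level w m))"

lemma ev_avgs: "t \<in> D \<inter> cone_level w m \<Longrightarrow> ev t \<in> avgs D w m"
  by (simp add: avgs_def midpoint_hull.base)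

lemma ev_image_unit_funs: "ev ` (D \<inter> cone_level w m) \<subseteq> unit_funs"
  using ev_unit_funs cone_levelD(1) by blast

lemma avgs_unit_funs: "avgs D w m \<subseteq> unit_funs"
  unfolding avgs_def by (rule midpoint_hull_unit_funs[OF ev_image_unit_funs])

lemma avgs_expectation:
  assumes "g \<in> avgs D w m"
  shows "\<epsilon> \<le> expectation g"
proof -
  have "\<epsilon> \<le> ip (\<lambda>x. 1) f \<and> ip (\<lambda>x. 1) f \<le> 1" if f: "f \<in> ev ` (D \<inter> cone_level w m)" for f
  proof -
    obtain t where t: "t \<in> T" "f = ev t" using f cone_levelD(1) by blast
    have "ip (\<lambda>x. 1) f = measure M (A t)"
      using sets.Int_space_eq2[OF events[OF t(1)]] by (simp add: ip_one t(2) ev_def)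
    then show ?thesis using prob_ge[OF t(1)] by simp
  qed
  from midpoint_hull_ip_bounds[OF _ ev_image_unit_funs one_unit_funs this]
  have "\<epsilon> \<le> ip (\<lambda>x. 1) g" using assms unfolding avgs_def by blast
  then show ?thesis by (simp add: ip_one)
qed

lemma avgs_mono: "D' \<subseteq> D \<Longrightarrow> (w, w') \<in> r \<Longrightarrow> avgs D' w' m \<subseteq> avgs D w m"
  unfolding avgs_def using cone_level_mono[of w w' m]
  by (intro midpoint_hull_mono image_mono) blast

text \<open>
  Strengthening a condition \<open>(w, L, D)\<close> leaves fewer averages and so can only raise the least squared
  norm of an average. That quantity is bounded by 1, so some condition nearly attains its supremum
  over all conditions; in particular none of its strengthenings raises it by \<open>\<eta>\<close> or more.
\<close>

lemma near_extremal:
  assumes "0 < \<eta>"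
  shows "\<exists>w L D a. dense_along w L D \<and> (\<forall>m\<in>L. \<forall>g\<in>avgs D w m. a \<le> ip g g) \<and>
    (\<forall>w' L' D'. dense_along w' L' D' \<longrightarrow> (\<exists>m\<in>L'. \<exists>g\<in>avgs D' w' m. ip g g < a + \<eta>))"
proof -
  define V where "V = {a. \<exists>w L D. dense_along w L D \<and> (\<forall>m\<in>L. \<forall>g\<in>avgs D w m. a \<le> ip g g)}"
  obtain w0 where w0: "w0 \<in> T" by (rule root)
  have "0 \<in> V"
    unfolding V_def using dense_along_T[OF w0 infinite_UNIV_nat] avgs_unit_funs ip_nonneg by blast
  have bdd: "a \<le> 1" if aV: "a \<in> V" for a
  proof -
    obtain w L D where D: "dense_along w L D" "\<forall>m\<in>L. \<forall>g\<in>avgs D w m. a \<le> ip g g"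
      using aV unfolding V_def by blast
    have "finite {m \<in> L. D \<inter> cone_level w m = {}}" "infinite L"
      using D(1) r_refl unfolding dense_along_def by blast+
    then have "infinite (L - {m \<in> L. D \<inter> cone_level w m = {}})" by simp
    then obtain m where "m \<in> L" "D \<inter> cone_level w m \<noteq> {}"
      using infinite_imp_nonempty by blast
    then obtain g where g: "g \<in> avgs D w m" "a \<le> ip g g" using ev_avgs D(2) by blast
    have "g \<in> unit_funs" using g(1) avgs_unit_funs by (rule rev_subsetD)
    then show ?thesis using g(2) ip_le_1[of g g] by linarith
  qed
  then have "bdd_above V" by (intro bdd_aboveI)
  obtain a where a: "a \<in> V" "Sup V - \<eta> < a"
    using less_cSupE[of "Sup V - \<eta>" V] assms \<open>0 \<in> V\<close> by auto
  have "a + \<eta> \<notin> V" using cSup_upper[OF _ \<open>bdd_above V\<close>, of "a + \<eta>"] a(2) by auto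
  then have "\<exists>m\<in>L'. \<exists>g\<in>avgs D' w' m. ip g g < a + \<eta>" if "dense_along w' L' D'" for w' L' D'
    using that unfolding V_def by force
  with a(1) show ?thesis unfolding V_def by blast
qed

text \<open>
  No \<open>k\<close> vectors can distinguish \<open>g\<close> from all events of level \<open>m\<close> above \<open>u\<close>: a finite, quantitative
  form of weak approximation. The vectors are collected in a list in order to bound their number.
\<close>

definition approximates :: "real \<Rightarrow> nat \<Rightarrow> 'a \<Rightarrow> nat \<Rightarrow> ('b \<Rightarrow> real) \<Rightarrow> bool" where
  "approximates \<kappa> k u m g \<longleftrightarrow> (\<forall>Fs. set Fs \<subseteq> unit_funs \<and> length Fs = k \<longrightarrow>
     (\<exists>t\<in>cone_level u m. \<forall>F\<in>set Fs. \<bar>ip F (ev t) - ip F g\<bar> \<le> \<kappa>))"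

text \<open>
  The function \<open>g\<close> plays the role of a weak limit of the events, one vector for each level. It is
  essential that \<open>m0\<close> depends on the number \<open>k\<close> of test vectors but not on the vectors, so that these
  may be chosen at level \<open>m\<close> itself.
\<close>

definition level_limit :: "real \<Rightarrow> 'a \<Rightarrow> nat set \<Rightarrow> (nat \<Rightarrow> 'b \<Rightarrow> real) \<Rightarrow> bool" where
  "level_limit \<kappa> w L g \<longleftrightarrow> w \<in> T \<and> infinite L \<and>
     (\<forall>m\<in>L. g m \<in> unit_funs \<and> \<epsilon> \<le> expectation (g m)) \<and>
     (\<forall>u k. (w, u) \<in> r \<longrightarrow> (\<exists>m0. \<forall>m\<in>L. m0 \<le> m \<longrightarrow> approximates \<kappa> k u m (g m)))"

text \<open>
  Two averages of almost minimal norm are close, by the parallelogram law, because their midpoint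
  is an average as well and hence not much shorter than they are.
\<close>

lemma averages_close:
  assumes "g \<in> avgs D w m" "h \<in> avgs D w m" "F \<in> unit_funs"
    and "\<And>f. f \<in> avgs D w m \<Longrightarrow> a \<le> ip f f"
    and "ip g g \<le> a + \<eta>" "ip h h \<le> a + \<eta>"
  shows "\<bar>ip F g - ip F h\<bar> \<le> sqrt (4 * \<eta>)"
proof -
  have u: "g \<in> unit_funs" "h \<in> unit_funs" using assms(1,2) avgs_unit_funs by blast+
  have "(\<lambda>x. (g x + h x) / 2) \<in> avgs D w m"
    using assms(1,2) unfolding avgs_def by (rule midpoint_hull.mid)
  then have "a \<le> ip (\<lambda>x. (g x + h x) / 2) (\<lambda>x. (g x + h x) / 2)" by (rule assms(4))
  then have "expectation (\<lambda>x. (g x - h x)\<^sup>2) \<le> 4 * \<eta>"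
    unfolding parallelogram[OF u] using assms(5,6) by linarith
  then have "sqrt (expectation (\<lambda>x. (g x - h x)\<^sup>2)) \<le> sqrt (4 * \<eta>)" by (rule real_sqrt_le_mono)
  with ip_diff_le_L2_distance[OF assms(3) u] show ?thesis by linarith
qed

text \<open>
  Start from a nearly extremal condition and take for \<open>g m\<close> an average of nearly minimal norm. If
  infinitely many levels \<open>m\<close> had test vectors \<open>Fs m\<close> that separate \<open>g m\<close> from all events above \<open>u\<close>,
  colour the nodes of these levels by the rounded inner products of their events with the test
  vectors. A dense colour class contains, at some level, an average \<open>h\<close> of nearly minimal norm. By
  extremality \<open>h\<close> is close to \<open>g m\<close>; and as the inner products with a test vector are nearly constant
  on the colour class, \<open>h\<close> is nearly indistinguishable from each event in it, a contradiction.
\<close>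

lemma level_limit_exists:
  assumes "0 < \<kappa>"
  shows "\<exists>w L g. level_limit \<kappa> w L g"
proof -
  \<comment> \<open>The error \<open>\<kappa>\<close> is split in halves: \<open>sqrt (4 * \<eta>)\<close> for \<open>averages_close\<close>, \<open>1 / N\<close> for the rounding.\<close>
  define \<eta> where "\<eta> = \<kappa>\<^sup>2 / 16"
  have \<eta>: "0 < \<eta>" "sqrt (4 * \<eta>) = \<kappa> / 2"
    using assms by (auto simp: \<eta>_def real_sqrt_divide)
  obtain N :: nat where N: "2 / \<kappa> < N" using reals_Archimedean2 by blast
  have "0 < 2 / \<kappa>" using assms by simp
  with N have N0: "0 < real N" by linarith
  have N1: "1 / N \<le> \<kappa> / 2" using N N0 assms by (simp add: field_simps)
  obtain w L D a where D: "dense_along w L D"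
    and low: "\<And>m g. m \<in> L \<Longrightarrow> g \<in> avgs D w m \<Longrightarrow> a \<le> ip g g"
    and high: "\<And>w' L' D'. dense_along w' L' D' \<Longrightarrow> \<exists>m\<in>L'. \<exists>g\<in>avgs D' w' m. ip g g < a + \<eta>"
    using near_extremal[OF \<eta>(1)] by blast
  have w: "w \<in> T" "infinite L" using D by (auto simp: dense_along_def)
  define L1 where "L1 = {m \<in> L. \<exists>g\<in>avgs D w m. ip g g < a + \<eta>}"
  have "infinite L1"
  proof
    assume "finite L1"
    then have "infinite (L - L1)" using w(2) by simp
    then have "dense_along w (L - L1) D"
      by (intro dense_along_refine[OF D r_refl[OF w(1)]]) auto
    from high[OF this] show False by (auto simp: L1_def)
  qed
  have "\<forall>m\<in>L1. \<exists>g. g \<in> avgs D w m \<and> ip g g < a + \<eta>" by (auto simp: L1_def)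
  then obtain g where g: "\<And>m. m \<in> L1 \<Longrightarrow> g m \<in> avgs D w m \<and> ip (g m) (g m) < a + \<eta>"
    by metis
  have "\<exists>m0. \<forall>m\<in>L1. m0 \<le> m \<longrightarrow> approximates \<kappa> k u m (g m)" if u: "(w, u) \<in> r" for u k
  proof (rule ccontr)
    assume neg: "\<not> ?thesis"
    define L2 where "L2 = {m \<in> L1. \<not> approximates \<kappa> k u m (g m)}"
    have "infinite L2"
      unfolding infinite_nat_iff_unbounded_le using neg by (auto simp: L2_def)
    have "\<forall>m\<in>L2. \<exists>Fs. set Fs \<subseteq> unit_funs \<and> length Fs = k \<and>
        \<not> (\<exists>t\<in>cone_level u m. \<forall>F\<in>set Fs. \<bar>ip F (ev t) - ip F (g m)\<bar> \<le> \<kappa>)"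
      by (auto simp: L2_def approximates_def)
    from bchoice[OF this] obtain Fs where Fs: "\<And>m. m \<in> L2 \<Longrightarrow> set (Fs m) \<subseteq> unit_funs"
        "\<And>m. m \<in> L2 \<Longrightarrow> length (Fs m) = k"
      and bad: "\<And>m t. m \<in> L2 \<Longrightarrow> t \<in> cone_level u m \<Longrightarrow>
        \<exists>F\<in>set (Fs m). \<not> \<bar>ip F (ev t) - ip F (g m)\<bar> \<le> \<kappa>"
      by blast
    define c where "c t = (if t \<in> T \<and> tree_length r t \<in> L2
      then map (\<lambda>F. \<lfloor>N * ip F (ev t)\<rfloor>) (Fs (tree_length r t)) else [])" for t
    define C where "C = insert [] {xs. set xs \<subseteq> {0..int N} \<and> length xs = k}"
    have "finite C" unfolding C_def using finite_lists_length_eq[of "{0..int N}" k] by simp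
    have cC: "c t \<in> C" for t
    proof (cases "t \<in> T \<and> tree_length r t \<in> L2")
      case True
      have "\<lfloor>N * ip F (ev t)\<rfloor> \<in> {0..int N}" if "F \<in> set (Fs (tree_length r t))" for F
      proof -
        have F: "F \<in> unit_funs" "ev t \<in> unit_funs" using that Fs(1) True ev_unit_funs by auto
        have "0 \<le> N * ip F (ev t)" "N * ip F (ev t) \<le> N"
          using ip_nonneg[OF F] ip_le_1[OF F] N0 by (auto simp: mult_left_le)
        then show ?thesis by (auto simp: floor_le_iff)
      qed
      then show ?thesis using True Fs(2) by (auto simp: c_def C_def)
    qed (auto simp: c_def C_def)
    have L2L: "L2 \<subseteq> L" by (auto simp: L2_def L1_def)
    have "dense_along u L2 D" by (rule dense_along_refine[OF D u L2L \<open>infinite L2\<close>])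
    from dense_along_colour[OF \<open>finite C\<close> this, of c] cC obtain i w' L' where
      w': "(u, w') \<in> r" "L' \<subseteq> L2" "dense_along w' L' {t \<in> D. c t = i}" by blast
    define D' where "D' = {t \<in> D. c t = i}"
    obtain m h where m: "m \<in> L'" and h: "h \<in> avgs D' w' m" "ip h h < a + \<eta>"
      using high[OF w'(3)] unfolding D'_def by blast
    have mL: "m \<in> L2" "m \<in> L1" "m \<in> L" using m w'(2) by (auto simp: L2_def L1_def)
    have "D' \<inter> cone_level w' m \<noteq> {}" using h(1) by (auto simp: avgs_def)
    then obtain t where t: "t \<in> D'" "t \<in> cone_level w' m" by blast
    have "t \<in> cone_level u m" using t(2) cone_level_mono[OF w'(1)] by blast
    from bad[OF mL(1) this] obtain F where F: "F \<in> set (Fs m)" "\<not> \<bar>ip F (ev t) - ip F (g m)\<bar> \<le> \<kappa>"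
      by blast
    have FU: "F \<in> unit_funs" using F(1) Fs(1)[OF mL(1)] by blast
    have "h \<in> avgs D w m"
      using h(1) avgs_mono[of D' D w w' m] r_trans[OF u w'(1)] by (auto simp: D'_def)
    then have "\<bar>ip F h - ip F (g m)\<bar> \<le> \<kappa> / 2"
      using averages_close[of h D w m "g m" F a \<eta>] g[OF mL(2)] h(2) FU low[OF mL(3)] \<eta>(2) by auto
    moreover have "ip F (ev t) - 1 / N \<le> ip F f \<and> ip F f \<le> ip F (ev t) + 1 / N"
      if f: "f \<in> ev ` (D' \<inter> cone_level w' m)" for f
    proof -
      obtain s where s: "s \<in> D'" "s \<in> cone_level w' m" "f = ev s" using f by blast
      have col: "c x = map (\<lambda>F. \<lfloor>N * ip F (ev x)\<rfloor>) (Fs m)" if "x \<in> cone_level w' m" for x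
        using cone_levelD[OF that] mL(1) by (simp add: c_def)
      have "c s = c t" using s(1) t(1) by (simp add: D'_def)
      then have "\<lfloor>N * ip F (ev s)\<rfloor> = \<lfloor>N * ip F (ev t)\<rfloor>"
        using col[OF s(2)] col[OF t(2)] F(1) by simp
      then have "\<bar>N * ip F (ev s) - N * ip F (ev t)\<bar> \<le> 1" by linarith
      then have "\<bar>N * (ip F (ev s) - ip F (ev t))\<bar> \<le> 1" by (simp add: right_diff_distrib)
      then have "N * \<bar>ip F (ev s) - ip F (ev t)\<bar> \<le> 1" by (simp add: abs_mult)
      then have "\<bar>ip F (ev s) - ip F (ev t)\<bar> \<le> 1 / N"
        using N0 by (simp add: pos_le_divide_eq mult.commute)
      then show ?thesis unfolding s(3) by linarith
    qed
    from midpoint_hull_ip_bounds[OF _ ev_image_unit_funs FU this]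
    have "ip F (ev t) - 1 / N \<le> ip F h \<and> ip F h \<le> ip F (ev t) + 1 / N"
      using h(1) unfolding avgs_def by blast
    ultimately show False using F(2) N1 by linarith
  qed
  moreover have "g m \<in> unit_funs \<and> \<epsilon> \<le> expectation (g m)" if "m \<in> L1" for m
    using g[OF that] avgs_unit_funs avgs_expectation by blast
  ultimately have "level_limit \<kappa> w L1 g"
    unfolding level_limit_def using w(1) \<open>infinite L1\<close> by blast
  then show ?thesis by blast
qed

lemma level_limitD:
  assumes "level_limit \<kappa> w L g"
  shows "w \<in> T" "infinite L" "\<And>m. m \<in> L \<Longrightarrow> g m \<in> unit_funs"
    "\<And>m. m \<in> L \<Longrightarrow> \<epsilon> \<le> expectation (g m)"
    "\<And>u k. (w, u) \<in> r \<Longrightarrow> \<exists>m0. \<forall>m\<in>L. m0 \<le> m \<longrightarrow> approximates \<kappa> k u m (g m)"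
  using assms unfolding level_limit_def by blast+

lemma level_limit_subset:
  assumes "level_limit \<kappa> w L g" "L' \<subseteq> L" "infinite L'"
  shows "level_limit \<kappa> w L' g"
  using assms unfolding level_limit_def by (meson subsetD)

lemma level_limit_norm:
  assumes "level_limit \<kappa> w L g" "m \<in> L"
  shows "\<epsilon>\<^sup>2 \<le> ip (g m) (g m)"
proof -
  have g: "g m \<in> unit_funs" "\<epsilon> \<le> expectation (g m)" using level_limitD[OF assms(1)] assms(2) by auto
  have "\<epsilon>\<^sup>2 \<le> (expectation (g m))\<^sup>2" using g(2) eps_pos by (intro power_mono) auto
  also have "\<dots> \<le> expectation (\<lambda>x. (g m x)\<^sup>2)"
    using integrable_unit_fun[OF g(1)] integrable_ip[OF g(1) g(1)]
    by (intro expectation_square_le) (auto simp: power2_eq_square)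
  finally show ?thesis by (simp add: ip_def power2_eq_square)
qed

section \<open>Choosing nodes of one level in several cones\<close>

text \<open>
  In addition to resembling \<open>g\<close> for the given test vectors, the events chosen in different cones have
  to be well correlated with each other.
\<close>

definition jointly_approximates ::
    "real \<Rightarrow> nat \<Rightarrow> 'a set \<Rightarrow> nat \<Rightarrow> ('b \<Rightarrow> real) \<Rightarrow> bool" where
  "jointly_approximates \<kappa> k U m g \<longleftrightarrow> (\<forall>Fs. set Fs \<subseteq> unit_funs \<and> length Fs = k \<longrightarrow>
    (\<exists>\<phi>. (\<forall>u\<in>U. \<phi> u \<in> cone_level u m) \<and>
      (\<forall>u\<in>U. \<forall>F\<in>set Fs. \<bar>ip F (ev (\<phi> u)) - ip F g\<bar> \<le> \<kappa>) \<and>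
      (\<forall>u\<in>U. \<forall>v\<in>U. u \<noteq> v \<longrightarrow> \<epsilon>\<^sup>2 - 2 * \<kappa> \<le> ip (ev (\<phi> u)) (ev (\<phi> v)))))"

lemma jointly_approximatesE:
  assumes "jointly_approximates \<kappa> k U m g" "set Fs \<subseteq> unit_funs" "length Fs = k"
  obtains \<phi> where "\<And>u. u \<in> U \<Longrightarrow> \<phi> u \<in> cone_level u m"
    "\<And>u F. u \<in> U \<Longrightarrow> F \<in> set Fs \<Longrightarrow> \<bar>ip F (ev (\<phi> u)) - ip F g\<bar> \<le> \<kappa>"
    "\<And>u v. u \<in> U \<Longrightarrow> v \<in> U \<Longrightarrow> u \<noteq> v \<Longrightarrow> \<epsilon>\<^sup>2 - 2 * \<kappa> \<le> ip (ev (\<phi> u)) (ev (\<phi> v))"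
proof -
  from assms(1)[unfolded jointly_approximates_def, THEN spec, THEN mp, OF conjI[OF assms(2,3)]]
  obtain \<phi> where "\<forall>u\<in>U. \<phi> u \<in> cone_level u m"
    "\<forall>u\<in>U. \<forall>F\<in>set Fs. \<bar>ip F (ev (\<phi> u)) - ip F g\<bar> \<le> \<kappa>"
    "\<forall>u\<in>U. \<forall>v\<in>U. u \<noteq> v \<longrightarrow> \<epsilon>\<^sup>2 - 2 * \<kappa> \<le> ip (ev (\<phi> u)) (ev (\<phi> v))"
    by (elim exE conjE) (rule that)
  then show thesis by (intro that[of \<phi>]) auto
qed

text \<open>
  The nodes are chosen one cone after another. The first event \<open>ev t\<close> is tested against \<open>g m\<close>, so
  that its inner product with \<open>g m\<close> is at least \<open>\<epsilon>\<^sup>2 - \<kappa>\<close>; it then serves as a test vector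
  for the remaining cones, which costs another \<open>\<kappa>\<close>.
\<close>

lemma same_level_selection:
  assumes lim: "level_limit \<kappa> w L g" and "finite U" "\<And>u. u \<in> U \<Longrightarrow> (w, u) \<in> r"
  shows "\<exists>m0. \<forall>m\<in>L. m0 \<le> m \<longrightarrow> jointly_approximates \<kappa> k U m (g m)"
  using assms(2,3)
proof (induction U arbitrary: k rule: finite_induct)
  case empty
  then show ?case by (simp add: jointly_approximates_def)
next
  case (insert u U)
  obtain m1 where m1: "\<And>m. m \<in> L \<Longrightarrow> m1 \<le> m \<Longrightarrow> approximates \<kappa> (Suc k) u m (g m)"
    using level_limitD(5)[OF lim, of u "Suc k"] insert.prems by blast
  obtain m2 where m2: "\<And>m. m \<in> L \<Longrightarrow> m2 \<le> m \<Longrightarrow> jointly_approximates \<kappa> (Suc k) U m (g m)"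
    using insert.IH[of "Suc k"] insert.prems by blast
  show ?case
    unfolding jointly_approximates_def
  proof (intro exI[of _ "max m1 m2"] ballI impI allI)
    fix m Fs
    assume m: "m \<in> L" "max m1 m2 \<le> m" and Fs: "set Fs \<subseteq> unit_funs \<and> length Fs = k"
    have gm: "g m \<in> unit_funs" using level_limitD(3)[OF lim m(1)] .
    have "set (g m # Fs) \<subseteq> unit_funs \<and> length (g m # Fs) = Suc k" using Fs gm by simp
    moreover have "approximates \<kappa> (Suc k) u m (g m)" using m by (intro m1) auto
    ultimately obtain t where t: "t \<in> cone_level u m"
      and tF: "\<And>F. F \<in> set (g m # Fs) \<Longrightarrow> \<bar>ip F (ev t) - ip F (g m)\<bar> \<le> \<kappa>"
      unfolding approximates_def by blast
    have evt: "ev t \<in> unit_funs" using ev_unit_funs cone_levelD(1)[OF t] .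
    have "jointly_approximates \<kappa> (Suc k) U m (g m)" using m by (intro m2) auto
    moreover have "set (ev t # Fs) \<subseteq> unit_funs" "length (ev t # Fs) = Suc k" using Fs evt by auto
    ultimately obtain \<phi> where \<phi>: "\<And>v. v \<in> U \<Longrightarrow> \<phi> v \<in> cone_level v m"
      and \<phi>F: "\<And>v F. v \<in> U \<Longrightarrow> F \<in> set (ev t # Fs) \<Longrightarrow> \<bar>ip F (ev (\<phi> v)) - ip F (g m)\<bar> \<le> \<kappa>"
      and \<phi>\<phi>: "\<And>v v'. v \<in> U \<Longrightarrow> v' \<in> U \<Longrightarrow> v \<noteq> v' \<Longrightarrow> \<epsilon>\<^sup>2 - 2 * \<kappa> \<le> ip (ev (\<phi> v)) (ev (\<phi> v'))"
      by (rule jointly_approximatesE) (rule that)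
    have new: "\<epsilon>\<^sup>2 - 2 * \<kappa> \<le> ip (ev t) (ev (\<phi> v))" if "v \<in> U" for v
      using \<phi>F[OF that, of "ev t"] tF[of "g m"] level_limit_norm[OF lim m(1)]
        ip_commute[of "g m" "ev t"] by (auto simp: abs_le_iff)
    define \<psi> where "\<psi> = \<phi>(u := t)"
    have \<psi>: "\<psi> u = t" "\<And>v. v \<in> U \<Longrightarrow> \<psi> v = \<phi> v" using insert.hyps(2) by (auto simp: \<psi>_def)
    have "\<epsilon>\<^sup>2 - 2 * \<kappa> \<le> ip (ev (\<psi> v)) (ev (\<psi> v'))"
      if vv': "v \<in> insert u U" "v' \<in> insert u U" "v \<noteq> v'" for v v'
    proof -
      consider "v = u" "v' \<in> U" | "v \<in> U" "v' = u" | "v \<in> U" "v' \<in> U" using vv' by blast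
      then show ?thesis
      proof cases
        case 1
        then show ?thesis using new[of v'] \<psi> by simp
      next
        case 2
        then show ?thesis using new[of v] \<psi> ip_commute[of "ev t" "ev (\<phi> v)"] by simp
      next
        case 3
        then show ?thesis using \<phi>\<phi>[of v v'] vv'(3) \<psi> by simp
      qed
    qed
    moreover have "\<bar>ip F (ev (\<psi> v)) - ip F (g m)\<bar> \<le> \<kappa>" if "v \<in> insert u U" "F \<in> set Fs" for v F
      using that tF[of F] \<phi>F[of v F] \<psi> by (cases "v = u") auto
    moreover have "\<psi> v \<in> cone_level v m" if "v \<in> insert u U" for v
      using that t \<phi>[of v] \<psi> by (cases "v = u") auto
    ultimately show "\<exists>\<phi>. (\<forall>v\<in>insert u U. \<phi> v \<in> cone_level v m) \<and>
        (\<forall>v\<in>insert u U. \<forall>F\<in>set Fs. \<bar>ip F (ev (\<phi> v)) - ip F (g m)\<bar> \<le> \<kappa>) \<and>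
        (\<forall>v\<in>insert u U. \<forall>v'\<in>insert u U. v \<noteq> v' \<longrightarrow> \<epsilon>\<^sup>2 - 2 * \<kappa> \<le> ip (ev (\<phi> v)) (ev (\<phi> v')))"
      by (intro exI[of _ \<psi>]) blast
  qed
qed

lemma correlated_level_limit_exists:
  assumes "0 < \<kappa>"
  shows "\<exists>w L g. level_limit \<kappa> w L g \<and>
    (\<forall>m\<in>L. \<forall>n\<in>L. m \<noteq> n \<longrightarrow> \<epsilon>\<^sup>2 - \<kappa> \<le> ip (g m) (g n))"
proof -
  obtain w L g where lim: "level_limit \<kappa> w L g" using level_limit_exists[OF assms] by blast
  have "\<exists>L'\<subseteq>L. infinite L' \<and> (\<forall>m\<in>L'. \<forall>n\<in>L'. m \<noteq> n \<longrightarrow> \<epsilon>\<^sup>2 - \<kappa> \<le> ip (g m) (g n))"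
    using level_limitD[OF lim] assms eps_pos by (intro infinite_subsequence_correlated) auto
  then obtain L' where "L' \<subseteq> L" "infinite L'"
    "\<forall>m\<in>L'. \<forall>n\<in>L'. m \<noteq> n \<longrightarrow> \<epsilon>\<^sup>2 - \<kappa> \<le> ip (g m) (g n)" by blast
  with level_limit_subset[OF lim] show ?thesis by blast
qed

section \<open>Building the strong subtree level by level\<close>

text \<open>
  The invariant of the construction. \<open>P\<close> is the set of nodes chosen so far, and \<open>L'\<close> an infinite set
  of levels on which the approximating vectors are still well correlated with all of \<open>P\<close>; the latter
  is what keeps the later choices correlated with the earlier ones.
\<close>

definition good_stage :: "real \<Rightarrow> (nat \<Rightarrow> 'b \<Rightarrow> real) \<Rightarrow> nat set \<Rightarrow> 'a set \<Rightarrow> nat set \<Rightarrow> bool" where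
  "good_stage \<kappa> g L P L' \<longleftrightarrow> finite P \<and> P \<subseteq> T \<and> L' \<subseteq> L \<and> infinite L' \<and>
     (\<forall>s\<in>P. \<forall>n\<in>L'. \<epsilon>\<^sup>2 - 2 * \<kappa> \<le> ip (ev s) (g n)) \<and>
     (\<forall>s\<in>P. \<forall>t\<in>P. \<epsilon>\<^sup>2 - 3 * \<kappa> \<le> ip (ev s) (ev t))"

lemma eps_sq_le: "t \<in> T \<Longrightarrow> \<epsilon>\<^sup>2 \<le> ip (ev t) (ev t)"
proof -
  assume t: "t \<in> T"
  have "\<epsilon> \<le> 1" using prob_ge[OF t] prob_le_1[of "A t"] by linarith
  then have "\<epsilon>\<^sup>2 \<le> \<epsilon>" using eps_pos by (simp add: power2_eq_square mult_left_le)
  then show ?thesis using prob_ge[OF t] ip_ev[OF t t] by simp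
qed

text \<open>
  At a large level \<open>m\<close> the new nodes are chosen with the old events and one later vector \<open>g n\<close> as test
  vectors. Testing against \<open>g n\<close> makes the new events well correlated with \<open>g n\<close>, because \<open>g m\<close> is.
  The choice depends on \<open>n\<close>, but there are only finitely many nodes at level \<open>m\<close>, so one choice works
  for infinitely many \<open>n\<close>, and these form the new set of levels.
\<close>

lemma extend_good_stage:
  assumes \<kappa>: "0 < \<kappa>" and lim: "level_limit \<kappa> w L g"
    and cor: "\<And>m n. m \<in> L \<Longrightarrow> n \<in> L \<Longrightarrow> m \<noteq> n \<Longrightarrow> \<epsilon>\<^sup>2 - \<kappa> \<le> ip (g m) (g n)"
    and stage: "good_stage \<kappa> g L P L1"
    and U: "finite U" "\<And>u. u \<in> U \<Longrightarrow> (w, u) \<in> r"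
  shows "\<exists>\<phi> m L2. (\<forall>u\<in>U. \<phi> u \<in> cone_level u m) \<and> good_stage \<kappa> g L (P \<union> \<phi> ` U) L2"
proof -
  have P: "finite P" "P \<subseteq> T" and L1: "L1 \<subseteq> L" "infinite L1"
    and Pg: "\<And>s n. s \<in> P \<Longrightarrow> n \<in> L1 \<Longrightarrow> \<epsilon>\<^sup>2 - 2 * \<kappa> \<le> ip (ev s) (g n)"
    and PP: "\<And>s t. s \<in> P \<Longrightarrow> t \<in> P \<Longrightarrow> \<epsilon>\<^sup>2 - 3 * \<kappa> \<le> ip (ev s) (ev t)"
    using stage unfolding good_stage_def by blast+
  obtain ps where ps: "set ps = P" using finite_list[OF P(1)] by blast
  obtain m0 where m0:
    "\<And>m. m \<in> L \<Longrightarrow> m0 \<le> m \<Longrightarrow> jointly_approximates \<kappa> (Suc (length ps)) U m (g m)"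
    using same_level_selection[OF lim U, of "Suc (length ps)"] by blast
  obtain m where m: "m \<in> L1" "m0 \<le> m"
    using L1(2) unfolding infinite_nat_iff_unbounded_le by blast
  have mL: "m \<in> L" using m(1) L1(1) by blast
  define Phi where "Phi n \<phi> \<longleftrightarrow>
      (\<forall>u\<in>U. \<bar>ip (g n) (ev (\<phi> u)) - ip (g n) (g m)\<bar> \<le> \<kappa>) \<and>
      (\<forall>u\<in>U. \<forall>s\<in>P. \<bar>ip (ev s) (ev (\<phi> u)) - ip (ev s) (g m)\<bar> \<le> \<kappa>) \<and>
      (\<forall>u\<in>U. \<forall>v\<in>U. u \<noteq> v \<longrightarrow> \<epsilon>\<^sup>2 - 2 * \<kappa> \<le> ip (ev (\<phi> u)) (ev (\<phi> v)))" for n \<phi>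
  have "\<exists>\<phi>\<in>PiE U (\<lambda>u. cone_level u m). Phi n \<phi>" if n: "n \<in> L1 - {m}" for n
  proof -
    let ?Fs = "g n # map ev ps"
    have "g n \<in> unit_funs" using n L1(1) level_limitD(3)[OF lim] by blast
    then have "set ?Fs \<subseteq> unit_funs" "length ?Fs = Suc (length ps)"
      using ps P(2) ev_unit_funs by auto
    with m0[OF mL m(2)] obtain \<phi> where \<phi>: "\<And>u. u \<in> U \<Longrightarrow> \<phi> u \<in> cone_level u m"
      "\<And>u F. u \<in> U \<Longrightarrow> F \<in> set ?Fs \<Longrightarrow> \<bar>ip F (ev (\<phi> u)) - ip F (g m)\<bar> \<le> \<kappa>"
      "\<And>u v. u \<in> U \<Longrightarrow> v \<in> U \<Longrightarrow> u \<noteq> v \<Longrightarrow> \<epsilon>\<^sup>2 - 2 * \<kappa> \<le> ip (ev (\<phi> u)) (ev (\<phi> v))"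
      by (rule jointly_approximatesE) (rule that)
    have "Phi n (restrict \<phi> U)" unfolding Phi_def using \<phi>(2,3) ps by auto
    moreover have "restrict \<phi> U \<in> PiE U (\<lambda>u. cone_level u m)" using \<phi>(1) by auto
    ultimately show ?thesis by blast
  qed
  then have "\<forall>n\<in>L1 - {m}. \<exists>\<phi>\<in>PiE U (\<lambda>u. cone_level u m). Phi n \<phi>" by blast
  moreover have "infinite (L1 - {m})" using L1(2) by simp
  moreover have "finite (PiE U (\<lambda>u. cone_level u m))"
    using U(1) finite_cone_level by (rule finite_PiE)
  ultimately obtain \<phi> where \<phi>: "\<phi> \<in> PiE U (\<lambda>u. cone_level u m)"
    and inf: "infinite {n \<in> L1 - {m}. Phi n \<phi>}"
    using pigeonhole_infinite_rel[of "L1 - {m}" "PiE U (\<lambda>u. cone_level u m)" Phi] by blast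
  define L2 where "L2 = {n \<in> L1 - {m}. Phi n \<phi>}"
  have L2: "L2 \<subseteq> L1" "infinite L2" using inf by (auto simp: L2_def)
  obtain n0 where n0: "n0 \<in> L2" using L2(2) infinite_imp_nonempty by blast
  have Phi: "Phi n \<phi>" "n \<in> L1" "n \<noteq> m" if "n \<in> L2" for n using that by (simp_all add: L2_def)
  note PhiD = Phi(1)[unfolded Phi_def, THEN conjunct1, rule_format]
    Phi(1)[unfolded Phi_def, THEN conjunct2, THEN conjunct1, rule_format]
    Phi(1)[unfolded Phi_def, THEN conjunct2, THEN conjunct2, rule_format]
  have \<phi>U: "\<phi> u \<in> cone_level u m" if "u \<in> U" for u using \<phi> that by auto
  have \<phi>T: "\<phi> u \<in> T" if "u \<in> U" for u using cone_levelD(1)[OF \<phi>U[OF that]] .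
  have new_g: "\<epsilon>\<^sup>2 - 2 * \<kappa> \<le> ip (ev (\<phi> u)) (g n)" if "u \<in> U" "n \<in> L2" for u n
  proof -
    have "\<bar>ip (g n) (ev (\<phi> u)) - ip (g n) (g m)\<bar> \<le> \<kappa>"
      by (rule PhiD(1)[OF that(2,1)])
    moreover have "\<epsilon>\<^sup>2 - \<kappa> \<le> ip (g n) (g m)"
      using Phi(2,3)[OF that(2)] mL L1(1) by (intro cor) auto
    ultimately show ?thesis using ip_commute[of "g n" "ev (\<phi> u)"] by linarith
  qed
  have old_new: "\<epsilon>\<^sup>2 - 3 * \<kappa> \<le> ip (ev s) (ev (\<phi> u))" if "u \<in> U" "s \<in> P" for u s
  proof -
    have "\<bar>ip (ev s) (ev (\<phi> u)) - ip (ev s) (g m)\<bar> \<le> \<kappa>"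
      by (rule PhiD(2)[OF n0 that])
    with Pg[OF that(2) m(1)] show ?thesis by linarith
  qed
  have new_new: "\<epsilon>\<^sup>2 - 3 * \<kappa> \<le> ip (ev (\<phi> u)) (ev (\<phi> v))" if "u \<in> U" "v \<in> U" for u v
  proof (cases "u = v")
    case True
    then show ?thesis using eps_sq_le[OF \<phi>T[OF that(2)]] \<kappa> by auto
  next
    case False
    then have "\<epsilon>\<^sup>2 - 2 * \<kappa> \<le> ip (ev (\<phi> u)) (ev (\<phi> v))"
      by (rule PhiD(3)[OF n0 that])
    then show ?thesis using \<kappa> by linarith
  qed
  have "good_stage \<kappa> g L (P \<union> \<phi> ` U) L2"
    unfolding good_stage_def
  proof (intro conjI ballI)
    show "finite (P \<union> \<phi> ` U)" "P \<union> \<phi> ` U \<subseteq> T" "L2 \<subseteq> L" "infinite L2"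
      using P U(1) \<phi>T L2 L1(1) by auto
    show "\<epsilon>\<^sup>2 - 2 * \<kappa> \<le> ip (ev s) (g n)" if "s \<in> P \<union> \<phi> ` U" "n \<in> L2" for s n
      using that Pg new_g L2(1) by auto
    show "\<epsilon>\<^sup>2 - 3 * \<kappa> \<le> ip (ev s) (ev t)" if "s \<in> P \<union> \<phi> ` U" "t \<in> P \<union> \<phi> ` U" for s t
      using that
    proof (elim UnE)
      assume "s \<in> \<phi> ` U" "t \<in> P"
      then show ?thesis using old_new ip_commute[of "ev s" "ev t"] by auto
    qed (use PP old_new new_new in auto)
  qed
  with \<phi>U show ?thesis by blast
qed

text \<open>
  The stages are tuples of the last level \<open>X\<close> chosen, the set \<open>P\<close> of all nodes chosen so far, the
  remaining set of levels and the level \<open>l\<close> of \<open>T\<close> that contains \<open>X\<close>. A step extends the stage by one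
  node above each immediate successor of a node of \<open>X\<close>.
\<close>

lemma strong_subtree_exists:
  assumes \<kappa>: "0 < \<kappa>"
  shows "\<exists>S. strong_subtree S T r \<and> tree_height S (Restr r S) = \<infinity> \<and>
    (\<forall>s\<in>S. \<forall>t\<in>S. \<epsilon>\<^sup>2 - 3 * \<kappa> \<le> measure M (A s \<inter> A t))"
proof -
  obtain w L g where lim: "level_limit \<kappa> w L g"
    and cor: "\<And>m n. m \<in> L \<Longrightarrow> n \<in> L \<Longrightarrow> m \<noteq> n \<Longrightarrow> \<epsilon>\<^sup>2 - \<kappa> \<le> ip (g m) (g n)"
    using correlated_level_limit_exists[OF \<kappa>] by blast
  note w = level_limitD(1)[OF lim]
  define succs where "succs X = (\<Union>x\<in>X. imm_succ T r x)" for X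
  define ok where "ok n \<sigma> = (case \<sigma> of (X, P, L', l) \<Rightarrow> good_stage \<kappa> g L P L' \<and> X \<subseteq> P \<and>
      X \<noteq> {} \<and> X \<subseteq> tree_level T r l \<and> (\<forall>x\<in>X. (w, x) \<in> r) \<and> (n = 0 \<longrightarrow> (\<exists>x. X = {x})))"
    for n :: nat and \<sigma> :: "'a set \<times> 'a set \<times> nat set \<times> nat"
  define next_to where "next_to \<sigma> \<tau> = (case \<sigma> of (X, P, L', l) \<Rightarrow> case \<tau> of (Y, Q, L'', l') \<Rightarrow>
      P \<subseteq> Q \<and> l < l' \<and> (\<exists>\<phi>. (\<forall>u\<in>succs X. \<phi> u \<in> cone_level u l') \<and> Y = \<phi> ` succs X))"
    for \<sigma> \<tau> :: "'a set \<times> 'a set \<times> nat set \<times> nat"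
  have "\<exists>\<sigma>. ok 0 \<sigma>"
  proof -
    have "good_stage \<kappa> g L {} L" using level_limitD(2)[OF lim] by (simp add: good_stage_def)
    from extend_good_stage[OF \<kappa> lim cor this, of "{w}"] obtain \<phi> m L2 where
      "\<phi> w \<in> cone_level w m" "good_stage \<kappa> g L {\<phi> w} L2" using r_refl[OF w] by auto
    then have "ok 0 ({\<phi> w}, {\<phi> w}, L2, m)" by (auto simp: ok_def cone_level_def)
    then show ?thesis by blast
  qed
  moreover have "\<exists>\<tau>. ok (Suc n) \<tau> \<and> next_to \<sigma> \<tau>" if "ok n \<sigma>" for n \<sigma>
  proof -
    obtain X P L' l where \<sigma>: "\<sigma> = (X, P, L', l)" by (cases \<sigma>)
    have X: "good_stage \<kappa> g L P L'" "X \<subseteq> P" "X \<noteq> {}" "X \<subseteq> tree_level T r l"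
      "\<And>x. x \<in> X \<Longrightarrow> (w, x) \<in> r"
      using that unfolding ok_def \<sigma> by auto
    have PT: "finite P" "P \<subseteq> T" using X(1) by (auto simp: good_stage_def)
    have XT: "X \<subseteq> T" and "finite X" using X(2) PT finite_subset by blast+
    then have "finite (succs X)"
      unfolding succs_def using finite_imm_succ by (intro finite_UN_I) auto
    have up: "(w, u) \<in> r" "tree_length r u = Suc l" "u \<in> T" if uX: "u \<in> succs X" for u
    proof -
      obtain x where x: "x \<in> X" "u \<in> imm_succ T r x" using uX by (auto simp: succs_def)
      show "(w, u) \<in> r" using X(5)[OF x(1)] imm_succD(2)[OF x(2)] r_trans by blast
      show "tree_length r u = Suc l" "u \<in> T"
        using imm_succD[OF x(2)] x(1) X(4) by (auto simp: tree_level_def)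
    qed
    have "succs X \<noteq> {}"
      using X(3) imm_succ_nonempty XT unfolding succs_def by blast
    obtain \<phi> m L2 where \<phi>: "\<forall>u\<in>succs X. \<phi> u \<in> cone_level u m"
      and stage: "good_stage \<kappa> g L (P \<union> \<phi> ` succs X) L2"
      using extend_good_stage[OF \<kappa> lim cor X(1) \<open>finite (succs X)\<close> up(1)] by blast
    have above: "(u, \<phi> u) \<in> r" "\<phi> u \<in> tree_level T r m" "(w, \<phi> u) \<in> r"
      if "u \<in> succs X" for u
      using \<phi> that r_trans[OF up(1)[OF that]] by (auto simp: cone_level_def)
    have "l < m"
    proof -
      obtain u where u: "u \<in> succs X" using \<open>succs X \<noteq> {}\<close> by blast
      have "tree_length r u \<le> tree_length r (\<phi> u)" using length_le[OF above(1)[OF u]] .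
      then show ?thesis using up(2)[OF u] above(2)[OF u] by (simp add: tree_level_def)
    qed
    have "ok (Suc n) (\<phi> ` succs X, P \<union> \<phi> ` succs X, L2, m)"
      using stage \<open>succs X \<noteq> {}\<close> above unfolding ok_def by auto
    moreover have "next_to \<sigma> (\<phi> ` succs X, P \<union> \<phi> ` succs X, L2, m)"
      using \<phi> \<open>l < m\<close> unfolding next_to_def \<sigma> by auto
    ultimately show ?thesis by blast
  qed
  ultimately obtain \<sigma> where \<sigma>: "\<And>n. ok n (\<sigma> n)" "\<And>n. next_to (\<sigma> n) (\<sigma> (Suc n))"
    using dependent_nat_choice[of ok "\<lambda>n. next_to"] by blast
  define X where "X n = fst (\<sigma> n)" for n
  define P where "P n = fst (snd (\<sigma> n))" for n
  define lv where "lv n = snd (snd (snd (\<sigma> n)))" for n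
  have ok: "good_stage \<kappa> g L (P n) (fst (snd (snd (\<sigma> n))))" "X n \<subseteq> P n"
    "X n \<subseteq> tree_level T r (lv n)" "n = 0 \<Longrightarrow> \<exists>x. X n = {x}" for n
    using \<sigma>(1)[of n] unfolding ok_def X_def P_def lv_def by (auto simp: case_prod_beta)
  have step: "P n \<subseteq> P (Suc n)" "lv n < lv (Suc n)"
    "\<exists>\<phi>. (\<forall>u\<in>succs (X n). \<phi> u \<in> cone_level u (lv (Suc n))) \<and> X (Suc n) = \<phi> ` succs (X n)" for n
    using \<sigma>(2)[of n] unfolding next_to_def X_def P_def lv_def by (auto simp: case_prod_beta)
  obtain x0 where x0: "X 0 = {x0}" using ok(4)[of 0] by blast
  have mono: "strict_mono lv" using step(2) by (simp add: strict_mono_Suc_iff)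
  have below: "\<exists>x\<in>X n. (x, y) \<in> r" if y: "y \<in> X (Suc n)" for n y
  proof -
    obtain u where u: "u \<in> succs (X n)" "y \<in> cone_level u (lv (Suc n))"
      using step(3)[of n] y by auto
    then obtain x where "x \<in> X n" "u \<in> imm_succ T r x" by (auto simp: succs_def)
    then show ?thesis using imm_succD(2) cone_levelD(3)[OF u(2)] r_trans by blast
  qed
  have succ: "\<exists>!y. y \<in> X (Suc n) \<and> (t, y) \<in> r" if x: "x \<in> X n" and t: "t \<in> imm_succ T r x" for n x t
  proof -
    obtain \<phi> where \<phi>: "\<And>u. u \<in> succs (X n) \<Longrightarrow> \<phi> u \<in> cone_level u (lv (Suc n))"
      and X': "X (Suc n) = \<phi> ` succs (X n)" using step(3)[of n] by blast
    have len: "tree_length r u = Suc (lv n)" if "u \<in> succs (X n)" for u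
      using that ok(3)[of n] imm_succD(3) by (fastforce simp: succs_def tree_level_def)
    have tX: "t \<in> succs (X n)" using x t by (auto simp: succs_def)
    show ?thesis
    proof (rule ex1I[of _ "\<phi> t"])
      show "\<phi> t \<in> X (Suc n) \<and> (t, \<phi> t) \<in> r"
        using tX X' cone_levelD(3)[OF \<phi>[OF tX]] by blast
      fix y assume y: "y \<in> X (Suc n) \<and> (t, y) \<in> r"
      then obtain u where u: "u \<in> succs (X n)" "y = \<phi> u" using X' by blast
      have "u = t"
        using below_same_length_eq[of u y t] cone_levelD(3)[OF \<phi>[OF u(1)]] y u(2)
          len[OF u(1)] len[OF tX] by simp
      then show "y = \<phi> t" using u(2) by simp
    qed
  qed
  have "incseq P" using step(1) by (rule incseq_SucI)
  have "\<epsilon>\<^sup>2 - 3 * \<kappa> \<le> measure M (A s \<inter> A t)"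
    if st: "s \<in> (\<Union>n. X n)" "t \<in> (\<Union>n. X n)" for s t
  proof -
    obtain i j where "s \<in> P i" "t \<in> P j" using st ok(2) by blast
    then have "s \<in> P (max i j)" "t \<in> P (max i j)"
      using incseqD[OF \<open>incseq P\<close>, of i "max i j"] incseqD[OF \<open>incseq P\<close>, of j "max i j"] by auto
    with ok(1)[of "max i j"] have "\<epsilon>\<^sup>2 - 3 * \<kappa> \<le> ip (ev s) (ev t)" "s \<in> T" "t \<in> T"
      unfolding good_stage_def by blast+
    then show ?thesis by (simp add: ip_ev)
  qed
  then show ?thesis
    using strong_subtree_of_level_sequence[of X lv x0, OF ok(3) mono x0 below succ]
    by (intro exI[of _ "\<Union>n. X n"] conjI ballI)
qed

end

theorem proposition6:
  fixes T :: "'a set" and r :: "'a rel" and M :: "'b measure"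
    and A :: "'a \<Rightarrow> 'b set" and \<epsilon> \<theta> :: real
  assumes "homogeneous_tree T r"
    and "prob_space M"
    and "\<And>t. t \<in> T \<Longrightarrow> A t \<in> sets M"
    and "\<epsilon> > 0"
    and "\<And>t. t \<in> T \<Longrightarrow> measure M (A t) \<ge> \<epsilon>"
    and "0 < \<theta>" and "\<theta> < \<epsilon>"
  shows "\<exists>S. strong_subtree S T r \<and> tree_height S (Restr r S) = \<infinity> \<and>
           (\<forall>s\<in>S. \<forall>t\<in>S. measure M (A s \<inter> A t) \<ge> \<theta>\<^sup>2)"
proof -
  interpret tree_events T r M A \<epsilon>
    using assms(1-5) by (simp add: tree_events_def tree_events_axioms_def hom_tree_def)
  define \<kappa> where "\<kappa> = (\<epsilon>\<^sup>2 - \<theta>\<^sup>2) / 3"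
  have "\<theta>\<^sup>2 < \<epsilon>\<^sup>2" using assms(6,7) by (intro power_strict_mono) auto
  then have "0 < \<kappa>" by (simp add: \<kappa>_def)
  moreover have "\<epsilon>\<^sup>2 - 3 * \<kappa> = \<theta>\<^sup>2" by (simp add: \<kappa>_def field_simps)
  ultimately show ?thesis using strong_subtree_exists[of \<kappa>] by simp
qed

end
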